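(* Let $(X,D,\omega,L,h)$, $\varepsilon$, $\lambda$ be as in the context. Fix a puncture $a_i\in D$ and write $z=z_i$, $R=R_i$, $V=V_i$. Let $k$ be a positive integer with $\varepsilon+\lambda/k>0$ satisfying 1. $\log k+\log(-\log R)-\log(\varepsilon+\lambda/k)>0$, 2. $k\ge(-9\log(R/2))^4$, 3. $k\ge 23190$. Let $\alpha$ be a holomorphic function on $V$, considered as a local section of $L^k$ via the trivialization of $L$ on $V$, and assume $$\|\alpha\|_R^2:=\int_{|z|\le R/2}|\alpha|_h^2\,\omega\le\nu .$$ Then for all $z\ne 0$ with $|z|^2\le e^{-(k-2)^{3/8}}$, $$|\alpha|_h^2\le 4\nu\,\rho_{0,k}(z).$$
   Context: Let $X$ be a compact Riemann surface, $D=\{a_1,\dots,a_N\}\subset X$ a finite set, $X_D=X\setminus D$, and $\omega$ a (smooth) Hermitian form on $X_D$. Let $L$ be a holomorphic line bundle of degree $d>0$ on $X$ and $h$ a singular Hermitian metric on $L$ such that: ($\alpha$) $h$ is smooth over $X_D$, and for every $j$ there is a trivialization of $L$ in a neighborhood $V_j$ of $a_j$, with associated coordinate $z_j$ (centered at $a_j$), such that $|1|_h^2(z_j)=|\log(|z_j|^2)|$; ($\beta$) there is $\varepsilon>0$ such that the curvature $R^L$ of $h$ satisfies $iR^L\ge\varepsilon\omega$ over $X_D$ and $iR^L=\omega$ on $V_j\setminus\{a_j\}$; in particular $\omega=\frac{i\,dz_j\wedge d\bar z_j}{|z_j|^2(\log|z_j|^2)^2}$ on $V_j\setminus\{a_j\}$.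 For each $j$, $R_j\in(0,1/2]$ is a radius such that the disc $|z_j|\le R_j$ is contained in $V_j$. The real number $\lambda$ is such that $\mathrm{Ric}(\omega)\ge\lambda\omega$ on $X_D$. On $L^k$, $|\cdot|_h$ is the norm induced by $h$; thus for a function $\alpha$ regarded as a section of $L^k$ near the puncture, $|\alpha|_h^2=|\alpha(z)|^2(\log\frac1{|z|^2})^k$. The Bergman kernel of the standard punctured disk is $$\rho_{0,k}(z)=\frac{(\log\frac1{|z|^2})^k}{2\pi(k-2)!}\sum_{a=1}^\infty a^{k-1}|z|^{2a},\qquad 0<|z|<1.$$ *)

theory Defs
  imports "HOL-Complex_Analysis.Complex_Analysis"
begin

section \<open>Riemann surfaces\<close>

text \<open>A chart is a pair of its domain and its coordinate function; the values of the
  coordinate function outside the domain are irrelevant.\<close>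

type_synonym 'a chart = "'a set \<times> ('a \<Rightarrow> complex)"

record 'a surface =
  space_top :: "'a topology"
  chart_atlas :: "'a chart set"

abbreviation points :: "'a surface \<Rightarrow> 'a set" where
  "points X \<equiv> topspace (space_top X)"

definition chart_inv :: "'a chart \<Rightarrow> complex \<Rightarrow> 'a" where
  "chart_inv c = inv_into (fst c) (snd c)"

definition is_chart :: "'a topology \<Rightarrow> 'a chart \<Rightarrow> bool" where
  "is_chart T c \<longleftrightarrow>
     openin T (fst c) \<and> open (snd c ` fst c) \<and>
     homeomorphic_map (subtopology T (fst c)) (top_of_set (snd c ` fst c)) (snd c)"

definition charts_compatible :: "'a chart \<Rightarrow> 'a chart \<Rightarrow> bool" where
  "charts_compatible c c' \<longleftrightarrow>
     (snd c' \<circ> chart_inv c) holomorphic_on snd c ` (fst c \<inter> fst c') \<and>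
     (snd c \<circ> chart_inv c') holomorphic_on snd c' ` (fst c \<inter> fst c')"

definition riemann_surface :: "'a surface \<Rightarrow> bool" where
  "riemann_surface X \<longleftrightarrow>
     points X \<noteq> {} \<and> Hausdorff_space (space_top X) \<and> connected_space (space_top X) \<and>
     (\<Union>c\<in>chart_atlas X. fst c) = points X \<and>
     (\<forall>c\<in>chart_atlas X. is_chart (space_top X) c) \<and>
     (\<forall>c\<in>chart_atlas X. \<forall>c'\<in>chart_atlas X. charts_compatible c c')"

definition compact_riemann_surface :: "'a surface \<Rightarrow> bool" where
  "compact_riemann_surface X \<longleftrightarrow> riemann_surface X \<and> compact_space (space_top X)"

text \<open>The given atlas need not be maximal; the holomorphic coordinates of \<open>X\<close> are the
  members of the maximal atlas it generates.\<close>

definition holo_charts :: "'a surface \<Rightarrow> 'a chart set" where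
  "holo_charts X = {c. is_chart (space_top X) c \<and> (\<forall>c'\<in>chart_atlas X. charts_compatible c c')}"

definition holo_fun_on :: "'a surface \<Rightarrow> ('a \<Rightarrow> complex) \<Rightarrow> 'a set \<Rightarrow> bool" where
  "holo_fun_on X f U \<longleftrightarrow>
     (\<forall>c\<in>holo_charts X. (f \<circ> chart_inv c) holomorphic_on snd c ` (fst c \<inter> U))"


section \<open>Smooth functions on open subsets of the plane\<close>

definition pd :: "complex \<Rightarrow> (complex \<Rightarrow> real) \<Rightarrow> complex \<Rightarrow> real" where
  "pd v f z = frechet_derivative f (at z) v"

primrec ck_on :: "nat \<Rightarrow> (complex \<Rightarrow> real) \<Rightarrow> complex set \<Rightarrow> bool" where
  "ck_on 0 f S \<longleftrightarrow> continuous_on S f"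
| "ck_on (Suc n) f S \<longleftrightarrow>
     (\<forall>z\<in>S. f differentiable (at z)) \<and> ck_on n (pd 1 f) S \<and> ck_on n (pd \<i> f) S"

definition smooth_fun_on :: "(complex \<Rightarrow> real) \<Rightarrow> complex set \<Rightarrow> bool" where
  "smooth_fun_on f S \<longleftrightarrow> (\<forall>n. ck_on n f S)"

text \<open>The mixed Wirtinger derivative of \<open>f\<close> by \<open>z\<close> and its conjugate, which is a quarter of
  the Laplacian.\<close>

definition ddbar :: "(complex \<Rightarrow> real) \<Rightarrow> complex \<Rightarrow> real" where
  "ddbar f z = (pd 1 (pd 1 f) z + pd \<i> (pd \<i> f) z) / 4"


section \<open>Real (1,1)-forms\<close>

text \<open>A real (1,1)-form is given by its coefficients: \<open>\<theta> c p\<close> is the real number \<open>g\<close> for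
  which the form equals \<open>i g dz \<and> d(conj z)\<close> at the point \<open>p\<close>, where \<open>z\<close> is the
  coordinate function of the chart \<open>c\<close>.\<close>

type_synonym 'a form11 = "'a chart \<Rightarrow> 'a \<Rightarrow> real"

definition hermitian_form_on :: "'a surface \<Rightarrow> 'a set \<Rightarrow> 'a form11 \<Rightarrow> bool" where
  "hermitian_form_on X Y \<omega> \<longleftrightarrow>
     (\<forall>c\<in>holo_charts X. \<forall>p\<in>fst c \<inter> Y. \<omega> c p > 0) \<and>
     (\<forall>c\<in>holo_charts X. smooth_fun_on (\<lambda>z. \<omega> c (chart_inv c z)) (snd c ` (fst c \<inter> Y))) \<and>
     (\<forall>c\<in>holo_charts X. \<forall>c'\<in>holo_charts X. \<forall>p\<in>fst c \<inter> fst c' \<inter> Y.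
        \<omega> c p = \<omega> c' p * (cmod (deriv (snd c' \<circ> chart_inv c) (snd c p)))\<^sup>2)"

definition form_scale :: "real \<Rightarrow> 'a form11 \<Rightarrow> 'a form11" where
  "form_scale r \<theta> = (\<lambda>c p. r * \<theta> c p)"

definition form_ge_on :: "'a surface \<Rightarrow> 'a set \<Rightarrow> 'a form11 \<Rightarrow> 'a form11 \<Rightarrow> bool" where
  "form_ge_on X Y \<theta> \<eta> \<longleftrightarrow> (\<forall>c\<in>holo_charts X. \<forall>p\<in>fst c \<inter> Y. \<theta> c p \<ge> \<eta> c p)"

definition form_eq_on :: "'a surface \<Rightarrow> 'a set \<Rightarrow> 'a form11 \<Rightarrow> 'a form11 \<Rightarrow> bool" where
  "form_eq_on X Y \<theta> \<eta> \<longleftrightarrow> (\<forall>c\<in>holo_charts X. \<forall>p\<in>fst c \<inter> Y. \<theta> c p = \<eta> c p)"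

definition ricci_form :: "'a form11 \<Rightarrow> 'a form11" where
  "ricci_form \<omega> = (\<lambda>c p. - ddbar (\<lambda>z. ln (\<omega> c (chart_inv c z))) (snd c p))"

text \<open>The integral of \<open>f \<omega>\<close> over a subset \<open>B\<close> of the domain of the chart \<open>c\<close>. The factor 2
  comes from \<open>i dz \<and> d(conj z) = 2 dx \<and> dy\<close>.\<close>

definition form_integral :: "'a chart \<Rightarrow> 'a set \<Rightarrow> ('a \<Rightarrow> ennreal) \<Rightarrow> 'a form11 \<Rightarrow> ennreal" where
  "form_integral c B f \<omega> =
     (\<integral>\<^sup>+ z\<in>snd c ` B. (f (chart_inv c z) * ennreal (2 * \<omega> c (chart_inv c z))) \<partial>lborel)"


section \<open>Holomorphic line bundles\<close>

text \<open>A trivialization is a pair of an open set \<open>U\<close> of the base and the fibre coordinate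
  \<open>\<tau>\<close> over it, that is \<open>v \<mapsto> (\<pi> v, \<tau> v)\<close> is the bundle chart onto \<open>U \<times> \<complex>\<close>. Since fibre
  coordinates differ by nowhere vanishing holomorphic factors, the trivializations also determine
  the vector space structure of the fibres and the complex structure of the total space.\<close>

type_synonym ('a, 'e) triv = "'a set \<times> ('e \<Rightarrow> complex)"

record ('a, 'e) line_bundle =
  total_space :: "'e set"
  bundle_proj :: "'e \<Rightarrow> 'a"
  triv_atlas :: "('a, 'e) triv set"

definition fibre :: "('a, 'e) line_bundle \<Rightarrow> 'a \<Rightarrow> 'e set" where
  "fibre L p = {v \<in> total_space L. bundle_proj L v = p}"

definition is_triv :: "'a surface \<Rightarrow> ('a, 'e) line_bundle \<Rightarrow> ('a, 'e) triv \<Rightarrow> bool" where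
  "is_triv X L t \<longleftrightarrow>
     openin (space_top X) (fst t) \<and> (\<forall>p\<in>fst t. bij_betw (snd t) (fibre L p) UNIV)"

definition trivs_compatible ::
  "'a surface \<Rightarrow> ('a, 'e) line_bundle \<Rightarrow> ('a, 'e) triv \<Rightarrow> ('a, 'e) triv \<Rightarrow> bool" where
  "trivs_compatible X L t t' \<longleftrightarrow>
     (\<exists>g. holo_fun_on X g (fst t \<inter> fst t') \<and>
          (\<forall>p\<in>fst t \<inter> fst t'. g p \<noteq> 0 \<and> (\<forall>v\<in>fibre L p. snd t' v = g p * snd t v)))"

definition holomorphic_line_bundle :: "'a surface \<Rightarrow> ('a, 'e) line_bundle \<Rightarrow> bool" where
  "holomorphic_line_bundle X L \<longleftrightarrow>
     bundle_proj L ` total_space L \<subseteq> points X \<and>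
     (\<Union>t\<in>triv_atlas L. fst t) = points X \<and>
     (\<forall>t\<in>triv_atlas L. is_triv X L t) \<and>
     (\<forall>t\<in>triv_atlas L. \<forall>t'\<in>triv_atlas L. trivs_compatible X L t t')"

definition local_trivs :: "'a surface \<Rightarrow> ('a, 'e) line_bundle \<Rightarrow> ('a, 'e) triv set" where
  "local_trivs X L = {t. is_triv X L t \<and> (\<forall>t'\<in>triv_atlas L. trivs_compatible X L t t')}"

text \<open>The section \<open>1\<close> of \<open>L\<close> in the trivialization \<open>t\<close>.\<close>

definition frame :: "('a, 'e) line_bundle \<Rightarrow> ('a, 'e) triv \<Rightarrow> 'a \<Rightarrow> 'e" where
  "frame L t p = inv_into (fibre L p) (snd t) 1"

definition nonzero_vec :: "('a, 'e) line_bundle \<Rightarrow> 'e \<Rightarrow> bool" where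
  "nonzero_vec L v \<longleftrightarrow>
     v \<in> total_space L \<and> (\<forall>t\<in>triv_atlas L. bundle_proj L v \<in> fst t \<longrightarrow> snd t v \<noteq> 0)"


subsection \<open>Degree\<close>

definition local_rep :: "'a chart \<Rightarrow> ('a, 'e) triv \<Rightarrow> ('a \<Rightarrow> 'e) \<Rightarrow> complex \<Rightarrow> complex" where
  "local_rep c t s z = snd t (s (chart_inv c z))"

text \<open>A meromorphic section, with its poles among the finitely many points of \<open>P\<close>, that does not
  vanish identically. On \<open>P\<close> itself the values of \<open>s\<close> are irrelevant.\<close>

definition nonzero_meromorphic_section ::
  "'a surface \<Rightarrow> ('a, 'e) line_bundle \<Rightarrow> 'a set \<Rightarrow> ('a \<Rightarrow> 'e) \<Rightarrow> bool" where
  "nonzero_meromorphic_section X L P s \<longleftrightarrow>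
     finite P \<and> P \<subseteq> points X \<and>
     (\<forall>p\<in>points X - P. s p \<in> fibre L p) \<and>
     (\<exists>p\<in>points X - P. nonzero_vec L (s p)) \<and>
     (\<forall>c\<in>holo_charts X. \<forall>t\<in>local_trivs X L.
        local_rep c t s meromorphic_on snd c ` (fst c \<inter> fst t) \<and>
        local_rep c t s holomorphic_on snd c ` (fst c \<inter> fst t - P))"

definition section_order ::
  "'a surface \<Rightarrow> ('a, 'e) line_bundle \<Rightarrow> ('a \<Rightarrow> 'e) \<Rightarrow> 'a \<Rightarrow> int" where
  "section_order X L s p =
     (let c = (SOME c. c \<in> holo_charts X \<and> p \<in> fst c);
          t = (SOME t. t \<in> local_trivs X L \<and> p \<in> fst t)
      in zorder (local_rep c t s) (snd c p))"

text \<open>The degree is the number of zeros minus the number of poles, counted with multiplicity, of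
  a nonzero meromorphic section; it does not depend on the section.\<close>

definition has_degree :: "'a surface \<Rightarrow> ('a, 'e) line_bundle \<Rightarrow> int \<Rightarrow> bool" where
  "has_degree X L d \<longleftrightarrow>
     (\<exists>P s. nonzero_meromorphic_section X L P s \<and>
            finite {p \<in> points X. section_order X L s p \<noteq> 0} \<and>
            d = (\<Sum>p\<in>{p \<in> points X. section_order X L s p \<noteq> 0}. section_order X L s p))"


subsection \<open>Hermitian metrics\<close>

text \<open>A metric is given by its squared norm \<open>h v\<close>. The values 0 and infinity on nonzero vectors
  are allowed for a singular metric: it is only required that the local weights
  \<open>ln (h (frame L t p))\<close> are locally integrable.\<close>

definition metric_weight ::
  "('a, 'e) line_bundle \<Rightarrow> ('e \<Rightarrow> ennreal) \<Rightarrow> 'a chart \<Rightarrow> ('a, 'e) triv \<Rightarrow> complex \<Rightarrow> ennreal" where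
  "metric_weight L h c t z = h (frame L t (chart_inv c z))"

definition singular_hermitian_metric ::
  "'a surface \<Rightarrow> ('a, 'e) line_bundle \<Rightarrow> ('e \<Rightarrow> ennreal) \<Rightarrow> bool" where
  "singular_hermitian_metric X L h \<longleftrightarrow>
     (\<forall>t\<in>local_trivs X L. \<forall>p\<in>fst t. \<forall>v\<in>fibre L p.
        h v = ennreal ((cmod (snd t v))\<^sup>2) * h (frame L t p)) \<and>
     (\<forall>c\<in>holo_charts X. \<forall>t\<in>local_trivs X L.
        (AE z in lebesgue. z \<in> snd c ` (fst c \<inter> fst t) \<longrightarrow>
           0 < metric_weight L h c t z \<and> metric_weight L h c t z < \<infinity>) \<and>
        (\<forall>K. compact K \<and> K \<subseteq> snd c ` (fst c \<inter> fst t) \<longrightarrow>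
           (\<lambda>z. ln (enn2real (metric_weight L h c t z))) absolutely_integrable_on K))"

definition metric_smooth_on ::
  "'a surface \<Rightarrow> ('a, 'e) line_bundle \<Rightarrow> ('e \<Rightarrow> ennreal) \<Rightarrow> 'a set \<Rightarrow> bool" where
  "metric_smooth_on X L h Y \<longleftrightarrow>
     (\<forall>c\<in>holo_charts X. \<forall>t\<in>local_trivs X L.
        (\<forall>z\<in>snd c ` (fst c \<inter> fst t \<inter> Y).
           0 < metric_weight L h c t z \<and> metric_weight L h c t z < \<infinity>) \<and>
        smooth_fun_on (\<lambda>z. enn2real (metric_weight L h c t z)) (snd c ` (fst c \<inter> fst t \<inter> Y)))"

text \<open>The form \<open>i R\<close> for the Chern curvature \<open>R\<close> of \<open>h\<close>, where \<open>h\<close> is smooth. Any trivialization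
  around \<open>p\<close> gives the same value.\<close>

definition i_curvature :: "'a surface \<Rightarrow> ('a, 'e) line_bundle \<Rightarrow> ('e \<Rightarrow> ennreal) \<Rightarrow> 'a form11" where
  "i_curvature X L h = (\<lambda>c p.
     (let t = (SOME t. t \<in> local_trivs X L \<and> p \<in> fst t)
      in - ddbar (\<lambda>z. ln (enn2real (metric_weight L h c t z))) (snd c p)))"


subsection \<open>Tensor powers\<close>

text \<open>The element \<open>c v\<^sup>k\<close> (tensor power) of the fibre of \<open>L\<^sup>k\<close>, for a nonzero vector \<open>v\<close> of \<open>L\<close>
  and a scalar \<open>c\<close>, as the set of all pairs \<open>(c', v')\<close> with \<open>c' v'\<^sup>k = c v\<^sup>k\<close>.\<close>

definition tensor_elem ::
  "('a, 'e) line_bundle \<Rightarrow> nat \<Rightarrow> complex \<Rightarrow> 'e \<Rightarrow> (complex \<times> 'e) set" where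
  "tensor_elem L k c v =
     {(c', v'). v' \<in> fibre L (bundle_proj L v) \<and> nonzero_vec L v' \<and>
        (\<forall>t\<in>triv_atlas L. bundle_proj L v \<in> fst t \<longrightarrow> c' * snd t v' ^ k = c * snd t v ^ k)}"

text \<open>The squared norm induced by \<open>h\<close> on \<open>L\<^sup>k\<close>; the representative of the tensor is immaterial.\<close>

definition power_metric :: "nat \<Rightarrow> ('e \<Rightarrow> ennreal) \<Rightarrow> (complex \<times> 'e) set \<Rightarrow> ennreal" where
  "power_metric k h \<xi> =
     (let (c, v) = (SOME x. x \<in> \<xi>) in ennreal ((cmod c)\<^sup>2) * h v ^ k)"

text \<open>The local section of \<open>L\<^sup>k\<close> that a function \<open>\<alpha>\<close> represents in a trivialization of \<open>L\<close>.\<close>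

definition power_section ::
  "('a, 'e) line_bundle \<Rightarrow> nat \<Rightarrow> ('a, 'e) triv \<Rightarrow> ('a \<Rightarrow> complex) \<Rightarrow> 'a \<Rightarrow> (complex \<times> 'e) set" where
  "power_section L k t \<alpha> p = tensor_elem L k (\<alpha> p) (frame L t p)"


section \<open>The Bergman kernel of the punctured disk\<close>

definition rho0 :: "nat \<Rightarrow> complex \<Rightarrow> real" where
  "rho0 k z = (ln (1 / (cmod z)\<^sup>2)) ^ k / (2 * pi * fact (k - 2)) *
     (\<Sum>a. real (Suc a) ^ (k - 1) * cmod z ^ (2 * Suc a))"

end

theory Submission
  imports Defs "HOL-Probability.Distributions" "HOL-Real_Asymp.Real_Asymp"
begin

text \<open>Put \<open>m = k - 2\<close>, \<open>T = - ln ((R / 2)\<^sup>2)\<close> and let \<open>\<Sum> c\<^sub>n z\<^sup>n\<close> be the power series of the given function.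
  The monomials are orthogonal for the radial weight, and with \<open>t = - ln \<bar>z\<bar>\<^sup>2\<close> the squared norm
  of \<open>z\<^sup>n\<close> over the disc of radius \<open>R / 2\<close> is \<open>2 \<pi> J\<^sub>n\<close>, where \<open>J\<^sub>n\<close> is the integral of
  \<open>t ^ m exp (- n t)\<close> over \<open>[T, \<infinity>)\<close>. Bessel's inequality bounds \<open>\<Sum> \<bar>c\<^sub>n\<bar>\<^sup>2 J\<^sub>n\<close>; since
  \<open>J\<^sub>0 = \<infinity>\<close>, the constant term vanishes, and Cauchy-Schwarz reduces the claim to comparing
  \<open>\<Sum> \<bar>z\<bar> ^ (2 n) / J\<^sub>n\<close> with the same sum over the full integrals \<open>m! / n ^ (m + 1)\<close>.
  For \<open>n \<le> N\<close>, where \<open>N T \<le> m / 2\<close>, half of the full integral lies above \<open>T\<close>. For \<open>n > N\<close>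
  the terms decay geometrically from the \<open>N\<close>-th one, because \<open>\<bar>z\<bar>\<^sup>2 exp C \<le> 1 / 3\<close> for
  \<open>C = 4 (m + 1) / N\<close>. With \<open>w = m powr (1 / 8)\<close> the hypotheses give \<open>T \<le> w\<^sup>2 / 4\<close> and
  \<open>\<bar>z\<bar>\<^sup>2 \<le> exp (- (w ^ 3))\<close>, so that \<open>N\<close> of order \<open>2 w ^ 6\<close>, hence \<open>C\<close> of order \<open>2 w\<^sup>2\<close>, will do.\<close>

section \<open>Integration on the plane\<close>

lemma nn_integral_lborel_translate:
  fixes f :: "'a::euclidean_space \<Rightarrow> ennreal"
  assumes [measurable]: "f \<in> borel_measurable borel"
  shows "(\<integral>\<^sup>+x. f (c + x) \<partial>lborel) = (\<integral>\<^sup>+x. f x \<partial>lborel)"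
proof -
  have "(\<integral>\<^sup>+x. f x \<partial>lborel) = (\<integral>\<^sup>+x. f x \<partial>distr lborel borel ((+) c))"
    by (simp add: lborel_distr_plus)
  also have "\<dots> = (\<integral>\<^sup>+x. f (c + x) \<partial>lborel)"
    by (subst nn_integral_distr) auto
  finally show ?thesis by simp
qed

text \<open>Translation invariance and Fubini suffice: the double integral of
  \<open>f (u * x) * b (y - u * x)\<close>, with \<open>b\<close> the indicator of the unit ball, is
  computed in both orders. Since \<open>b\<close> is invariant under multiplication by
  \<open>- u\<close>, the same positive finite mass \<open>B\<close> appears on both sides and
  cancels.\<close>

lemma nn_integral_lborel_complex_rotate:
  fixes f :: "complex \<Rightarrow> ennreal"
  assumes [measurable]: "f \<in> borel_measurable borel" and u: "cmod u = 1"
  shows "(\<integral>\<^sup>+x. f (u * x) \<partial>lborel) = (\<integral>\<^sup>+x. f x \<partial>lborel)"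
proof -
  define b :: "complex \<Rightarrow> ennreal" where "b = indicator (ball 0 1)"
  define B where "B = emeasure lborel (ball (0::complex) 1)"
  have [measurable]: "b \<in> borel_measurable borel" unfolding b_def by (intro borel_measurable_indicator) auto
  have b_int: "(\<integral>\<^sup>+x. b x \<partial>lborel) = B" by (simp add: b_def B_def)
  have B: "B \<noteq> 0" "B \<noteq> \<infinity>"
    by (auto simp: B_def emeasure_ball unit_ball_vol_2 ennreal_mult_eq_top_iff)
  have uu: "u \<noteq> 0" using u by auto
  have b_inv: "b (- (u * x)) = b x" for x
    by (simp add: b_def indicator_def norm_mult u)
  have "(\<integral>\<^sup>+x. f (u * x) \<partial>lborel) * B = (\<integral>\<^sup>+x. f (u * x) * (\<integral>\<^sup>+y. b (- (u * x) + y) \<partial>lborel) \<partial>lborel)"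
    by (subst nn_integral_lborel_translate) (simp_all add: b_int nn_integral_multc)
  also have "\<dots> = (\<integral>\<^sup>+x. (\<integral>\<^sup>+y. f (u * x) * b (- (u * x) + y) \<partial>lborel) \<partial>lborel)"
    by (simp add: nn_integral_cmult)
  also have "\<dots> = (\<integral>\<^sup>+y. (\<integral>\<^sup>+x. f (u * x) * b (- (u * x) + y) \<partial>lborel) \<partial>lborel)"
    by (rule lborel_pair.Fubini') simp
  \<comment> \<open>The shift of \<open>x\<close> by \<open>y / u\<close> moves the variable
    \<open>y\<close> from \<open>b\<close> into \<open>f\<close>.\<close>
  also have "\<dots> = (\<integral>\<^sup>+y. (\<integral>\<^sup>+x. f (u * (y / u + x)) * b (- (u * (y / u + x)) + y) \<partial>lborel) \<partial>lborel)"
    by (intro nn_integral_cong nn_integral_lborel_translate[symmetric,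
          where f = "\<lambda>x. f (u * x) * b (- (u * x) + _)"]) simp
  also have "\<dots> = (\<integral>\<^sup>+y. (\<integral>\<^sup>+x. f (u * x + y) * b x \<partial>lborel) \<partial>lborel)"
    using uu by (simp add: distrib_left b_inv add.commute)
  also have "\<dots> = (\<integral>\<^sup>+x. (\<integral>\<^sup>+y. f (u * x + y) * b x \<partial>lborel) \<partial>lborel)"
    by (rule lborel_pair.Fubini'[symmetric]) simp
  also have "\<dots> = (\<integral>\<^sup>+x. (\<integral>\<^sup>+y. f (u * x + y) \<partial>lborel) * b x \<partial>lborel)"
    by (simp add: nn_integral_multc)
  also have "\<dots> = (\<integral>\<^sup>+x. f x \<partial>lborel) * B"
    by (subst nn_integral_lborel_translate) (simp_all add: b_int nn_integral_cmult)
  finally show ?thesis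
    using B by (simp add: mult.commute[of _ B] ennreal_mult_cancel_left)
qed

lemma nn_integral_exp_Ioi:
  "(\<integral>\<^sup>+t. ennreal (exp (- t)) * indicator {x<..} t \<partial>lborel) = ennreal (exp (- x))"
proof -
  have "(\<integral>\<^sup>+t. ennreal (exp (- t)) * indicator {x<..} t \<partial>lborel)
      = (\<integral>\<^sup>+t. ennreal (exp (- t)) * indicator {x..} t \<partial>lborel)"
    by (rule nn_integral_cong_AE, rule AE_mp[OF AE_lborel_singleton[of x]])
       (auto simp: indicator_def)
  also have "\<dots> = ennreal (0 - (- exp (- x)))"
  proof (rule nn_integral_FTC_atLeast)
    show "((\<lambda>t::real. - exp (- t)) \<longlongrightarrow> 0) at_top" by real_asymp
  qed (auto intro!: derivative_eq_intros)
  finally show ?thesis by simp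
qed

text \<open>Such measures on the line are determined by their values on the rays
  \<open>{x<..}\<close>. The preimage of a ray is a disc of area \<open>pi * exp (- x)\<close>, up
  to the origin, where \<open>ln 0 = 0\<close> but which is a null set.\<close>

lemma distr_minus_ln_norm_square:
  "distr lborel borel (\<lambda>z::complex. - ln ((cmod z)\<^sup>2)) = density lborel (\<lambda>t. ennreal (pi * exp (- t)))"
proof (rule measure_eqI_lessThan)
  fix x :: real
  have dens: "emeasure (density lborel (\<lambda>t. ennreal (pi * exp (- t)))) {x<..} = ennreal (pi * exp (- x))"
    by (simp add: emeasure_density ennreal_mult mult.assoc nn_integral_cmult nn_integral_exp_Ioi)
  have "emeasure (distr lborel borel (\<lambda>z::complex. - ln ((cmod z)\<^sup>2))) {x<..}
      = emeasure lborel {z::complex. x < - ln ((cmod z)\<^sup>2)}"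
    by (subst emeasure_distr) (auto intro!: arg_cong2[where f=emeasure])
  also have "\<dots> = emeasure lborel (ball (0::complex) (exp (- x / 2)))"
  proof -
    have "(x < - ln ((cmod z)\<^sup>2)) = (cmod z < exp (- x / 2))" if "z \<noteq> 0" for z :: complex
    proof -
      have "(x < - ln ((cmod z)\<^sup>2)) = (ln (cmod z) < - x / 2)"
        using that by (auto simp: ln_realpow)
      also have "\<dots> = (cmod z < exp (- x / 2))"
        using that by (metis exp_less_cancel_iff exp_ln zero_less_norm_iff)
      finally show ?thesis .
    qed
    then have AE: "AE z in lborel. (z \<in> {z::complex. x < - ln ((cmod z)\<^sup>2)}) = (z \<in> ball 0 (exp (- x / 2)))"
      using AE_lborel_singleton[of "0::complex"] by (auto elim!: eventually_mono)
    have m: "{z::complex. x < - ln ((cmod z)\<^sup>2)} \<in> sets lborel"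
        by simp
    show ?thesis
      by (rule emeasure_eq_AE[OF AE m]) simp
  qed
  also have "\<dots> = ennreal (pi * exp (- x))"
  proof -
    have "(exp (- x / 2))\<^sup>2 = exp (- x)"
      by (subst exp_double[symmetric]) simp
    then show ?thesis
      by (simp add: emeasure_ball unit_ball_vol_2)
  qed
  finally show eq: "emeasure (distr lborel borel (\<lambda>z::complex. - ln ((cmod z)\<^sup>2))) {x<..}
      = emeasure (density lborel (\<lambda>t. ennreal (pi * exp (- t)))) {x<..}"
    using dens by simp
  show "emeasure (distr lborel borel (\<lambda>z::complex. - ln ((cmod z)\<^sup>2))) {x<..} < \<infinity>"
    unfolding eq dens by simp
qed auto

lemma nn_integral_radial:
  assumes [measurable]: "g \<in> borel_measurable borel"
  shows "(\<integral>\<^sup>+z. g (- ln ((cmod z)\<^sup>2)) \<partial>lborel) = (\<integral>\<^sup>+t. ennreal (pi * exp (- t)) * g t \<partial>lborel)"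
proof -
  have "(\<integral>\<^sup>+z. g (- ln ((cmod z)\<^sup>2)) \<partial>lborel)
      = (\<integral>\<^sup>+t. g t \<partial>distr lborel borel (\<lambda>z::complex. - ln ((cmod z)\<^sup>2)))"
    by (subst nn_integral_distr) auto
  also have "\<dots> = (\<integral>\<^sup>+t. ennreal (pi * exp (- t)) * g t \<partial>lborel)"
    unfolding distr_minus_ln_norm_square by (subst nn_integral_density) auto
  finally show ?thesis .
qed

text \<open>Bessel's inequality for the orthonormal functions \<open>e t ^ n\<close>: the mean
  square of \<open>g - P\<close> over the unit circle is nonnegative, where \<open>P\<close> is the
  Taylor polynomial.\<close>

lemma bessel_unit_circle:
  assumes g: "g holomorphic_on ball 0 r" and r: "1 < r"
  shows "ennreal (\<Sum>n\<le>M. (cmod ((deriv ^^ n) g 0 / fact n))\<^sup>2)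
    \<le> (\<integral>\<^sup>+t. indicator {0..1} t * ennreal ((cmod (g (cis (2 * pi * t))))\<^sup>2) \<partial>lborel)"
proof -
  define c where "c n = (deriv ^^ n) g 0 / fact n" for n
  define e where "e t = cis (2 * pi * t)" for t
  define P where "P t = (\<Sum>n\<le>M. c n * e t ^ n)" for t
  define S where "S = (\<Sum>n\<le>M. (cmod (c n))\<^sup>2)"
  have e_norm [simp]: "cmod (e t) = 1" for t by (simp add: e_def)
  have e_circle: "circlepath 0 1 t = e t" for t
    by (simp add: circlepath e_def cis_conv_exp mult_ac)
  have e_cont: "continuous_on A e" for A
    unfolding e_def by (intro continuous_intros)
  \<comment> \<open>Taylor coefficients are Fourier coefficients, by Cauchy's formula: the
    derivative of the path contributes one factor \<open>e t\<close>, and \<open>1 / e t ^ n\<close>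
    is the conjugate of \<open>e t ^ n\<close>.\<close>
  have coef: "((\<lambda>t. f (e t) * cnj (e t ^ n)) has_integral (deriv ^^ n) f 0 / fact n) {0..1}"
    if f: "f holomorphic_on ball 0 r" for f n
  proof -
    have "((\<lambda>u. f u / (u - 0) ^ Suc n) has_contour_integral ((2 * pi * \<i>) / fact n * (deriv ^^ n) f 0)) (circlepath 0 1)"
      using r by (intro Cauchy_has_contour_integral_higher_derivative_circlepath
          holomorphic_on_imp_continuous_on holomorphic_on_subset[OF f]) auto
    then have "((\<lambda>t. f (e t) / e t ^ Suc n * (2 * pi * \<i> * e t)) has_integral ((2 * pi * \<i>) / fact n * (deriv ^^ n) f 0)) {0..1}"
      unfolding has_contour_integral_def
      by (rule has_integral_eq[rotated])
         (auto simp: e_circle vector_derivative_circlepath01 e_def cis_conv_exp mult_ac)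
    then have "((\<lambda>t. f (e t) / e t ^ Suc n * (2 * pi * \<i> * e t) * (1 / (2 * pi * \<i>))) has_integral
        ((2 * pi * \<i>) / fact n * (deriv ^^ n) f 0) * (1 / (2 * pi * \<i>))) {0..1}"
      by (rule has_integral_mult_left)
    moreover have "f (e t) / e t ^ Suc n * (2 * pi * \<i> * e t) * (1 / (2 * pi * \<i>)) = f (e t) * cnj (e t ^ n)" for t
    proof -
      have "e t \<noteq> 0" using e_norm[of t] by (metis norm_zero zero_neq_one)
      moreover have "cnj (e t ^ n) = 1 / e t ^ n"
        by (simp add: e_def cis_cnj power_inverse field_simps flip: cis_inverse)
      ultimately show ?thesis by (simp add: field_simps)
    qed
    ultimately have "((\<lambda>t. f (e t) * cnj (e t ^ n)) has_integral
        ((2 * pi * \<i>) / fact n * (deriv ^^ n) f 0) * (1 / (2 * pi * \<i>))) {0..1}"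
      by (simp only:)
    then show ?thesis by simp
  qed
  \<comment> \<open>A general \<open>G\<close> covers both \<open>g\<close> and \<open>P\<close>,
    which share the Fourier coefficients \<open>c n\<close> for \<open>n \<le> M\<close>.\<close>
  have against_P: "((\<lambda>t. G t * cnj (P t)) has_integral of_real S) {0..1}"
    if "\<And>n. n \<le> M \<Longrightarrow> ((\<lambda>t. G t * cnj (e t ^ n)) has_integral c n) {0..1}" for G
  proof -
    have "((\<lambda>t. \<Sum>n\<le>M. cnj (c n) * (G t * cnj (e t ^ n))) has_integral (\<Sum>n\<le>M. cnj (c n) * c n)) {0..1}"
      by (intro has_integral_sum has_integral_mult_right that) auto
    moreover have "(\<Sum>n\<le>M. cnj (c n) * (G t * cnj (e t ^ n))) = G t * cnj (P t)" for t
      by (simp add: P_def sum_distrib_left mult_ac)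
    moreover have "(\<Sum>n\<le>M. cnj (c n) * c n) = of_real S"
      by (simp add: S_def mult.commute del: of_real_power flip: complex_norm_square)
    ultimately show ?thesis by simp
  qed
  have gP: "((\<lambda>t. g (e t) * cnj (P t)) has_integral of_real S) {0..1}"
    using coef[OF g] by (intro against_P) (simp add: c_def)
  have PP: "((\<lambda>t. P t * cnj (P t)) has_integral of_real S) {0..1}"
  proof (rule against_P)
    fix n assume n: "n \<le> M"
    have "((\<lambda>t. e t ^ m * cnj (e t ^ n)) has_integral (if m = n then 1 else 0)) {0..1}" for m
    proof -
      have "(deriv ^^ n) (\<lambda>z::complex. z ^ m) 0 = (if m = n then fact n else 0)"
        using higher_deriv_power[of n 0 m 0]
        by (auto simp: pochhammer_fact pochhammer_0_left power_0_left)
      then show ?thesis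
        using coef[of "\<lambda>z. z ^ m" n] by (cases "m = n") (simp_all add: holomorphic_intros)
    qed
    then have "((\<lambda>t. \<Sum>m\<le>M. c m * (e t ^ m * cnj (e t ^ n))) has_integral (\<Sum>m\<le>M. c m * (if m = n then 1 else 0))) {0..1}"
      by (intro has_integral_sum has_integral_mult_right) auto
    then show "((\<lambda>t. P t * cnj (e t ^ n)) has_integral c n) {0..1}"
      using n by (simp add: P_def sum_distrib_right mult.assoc if_distrib cong: if_cong)
  qed
  have "continuous_on {0..1} (\<lambda>t. g (e t))"
    using r by (intro continuous_on_compose2[OF holomorphic_on_imp_continuous_on[OF g] e_cont]) auto
  then have "(\<lambda>t. (cmod (g (e t)))\<^sup>2) integrable_on {0..1}"
    by (intro integrable_continuous_real continuous_intros)
  then obtain I where I: "((\<lambda>t. (cmod (g (e t)))\<^sup>2) has_integral I) {0..1}" by blast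
  \<comment> \<open>In the expanded square the cross term contributes \<open>- 2 * S\<close> and the
    square of \<open>P\<close> contributes \<open>S\<close>.\<close>
  have "((\<lambda>t. (cmod (g (e t)))\<^sup>2 - 2 * Re (g (e t) * cnj (P t)) + Re (P t * cnj (P t))) has_integral
      (I - 2 * Re (of_real S) + Re (of_real S))) {0..1}"
    by (intro has_integral_add has_integral_diff has_integral_mult_right has_integral_Re I gP PP)
  moreover have "(cmod (g (e t)))\<^sup>2 - 2 * Re (g (e t) * cnj (P t)) + Re (P t * cnj (P t)) = (cmod (g (e t) - P t))\<^sup>2" for t
    unfolding cmod_power2 by (simp add: power2_eq_square algebra_simps)
  ultimately have "((\<lambda>t. (cmod (g (e t) - P t))\<^sup>2) has_integral (I - S)) {0..1}"
    by simp
  then have "0 \<le> I - S"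
    by (rule has_integral_nonneg) simp
  moreover have "(\<integral>\<^sup>+t. indicator {0..1} t * ennreal ((cmod (g (e t)))\<^sup>2) \<partial>lborel) = ennreal I"
    using nn_integral_has_integral_lebesgue'[OF _ I] by (simp add: mult.commute)
  ultimately show ?thesis
    by (simp add: e_def S_def c_def ennreal_leI)
qed

lemma higher_deriv_scale:
  assumes f: "f holomorphic_on ball 0 r" and z: "cmod z < r"
  shows "(deriv ^^ n) (\<lambda>u. f (z * u)) 0 = z ^ n * (deriv ^^ n) f 0"
proof -
  define S where "S = (\<lambda>u. z * u) -` ball 0 r"
  have "open S" unfolding S_def by (intro open_vimage) (auto intro!: continuous_intros)
  moreover have "0 < r" using z norm_ge_zero[of z] by linarith
  ultimately show ?thesis
    using higher_deriv_compose_linear[of f "ball 0 r" S 0 z n] f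
    by (auto simp: S_def)
qed

text \<open>For \<open>n > 0\<close> this is \<open>\<Gamma>(m + 1, n * T) / n ^ (m + 1)\<close>,
  with the upper incomplete gamma function. The values lie in \<open>ennreal\<close> because the
  integral diverges for \<open>n = 0\<close>.\<close>

definition upper_gamma :: "nat \<Rightarrow> real \<Rightarrow> nat \<Rightarrow> ennreal" where
  "upper_gamma m T n = (\<integral>\<^sup>+t. ennreal (t ^ m * exp (- (real n * t))) * indicator {T..} t \<partial>lborel)"

text \<open>In terms of \<open>t = - ln \<bar>z\<bar>\<^sup>2\<close>, this is the Lebesgue density of \<open>\<bar>1\<bar>\<^sub>h\<^sup>2 \<omega>\<close> on \<open>L\<^sup>k\<close> for
  \<open>k = m + 2\<close>, cut off outside the disc \<open>t \<ge> T\<close>; it vanishes at \<open>z = 0\<close> since \<open>ln 0 = 0\<close>.\<close>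

definition cusp_weight :: "nat \<Rightarrow> real \<Rightarrow> complex \<Rightarrow> ennreal" where
  "cusp_weight m T z = (let t = - ln ((cmod z)\<^sup>2) in ennreal (2 * t ^ m * exp t) * indicator {T..} t)"

lemma measurable_cusp_weight [measurable]: "cusp_weight m T \<in> borel_measurable borel"
  unfolding cusp_weight_def Let_def by measurable

lemma nn_integral_power_cusp_weight:
  assumes T: "0 < T"
  shows "(\<integral>\<^sup>+z. ennreal ((cmod z) ^ (2 * n)) * cusp_weight m T z \<partial>lborel) = ennreal (2 * pi) * upper_gamma m T n"
proof -
  have "(\<integral>\<^sup>+z. ennreal ((cmod z) ^ (2 * n)) * cusp_weight m T z \<partial>lborel)
      = (\<integral>\<^sup>+z. (\<lambda>t. ennreal (exp (- (real n * t))) * (ennreal (2 * t ^ m * exp t) * indicator {T..} t)) (- ln ((cmod z)\<^sup>2)) \<partial>lborel)"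
  proof (intro nn_integral_cong)
    fix z :: complex
    show "ennreal ((cmod z) ^ (2 * n)) * cusp_weight m T z
      = (\<lambda>t. ennreal (exp (- (real n * t))) * (ennreal (2 * t ^ m * exp t) * indicator {T..} t)) (- ln ((cmod z)\<^sup>2))"
    \<comment> \<open>At \<open>z = 0\<close> the convention \<open>ln 0 = 0\<close> makes the
      exponential 1 for every \<open>n\<close>, unlike \<open>0 ^ (2 * n)\<close>; both sides still
      vanish because \<open>t = 0\<close> lies below \<open>T\<close>.\<close>
    proof (cases "z = 0")
      case True
      then show ?thesis using T by (simp add: cusp_weight_def Let_def)
    next
      case False
      then have "exp (- (real n * - ln ((cmod z)\<^sup>2))) = (cmod z) ^ (2 * n)"
        by (simp add: exp_of_nat_mult power_mult)
      then show ?thesis by (simp add: cusp_weight_def Let_def)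
    qed
  qed
  also have "\<dots> = (\<integral>\<^sup>+t. ennreal (pi * exp (- t)) * (ennreal (exp (- (real n * t))) * (ennreal (2 * t ^ m * exp t) * indicator {T..} t)) \<partial>lborel)"
    by (rule nn_integral_radial) measurable
  also have "\<dots> = (\<integral>\<^sup>+t. ennreal (2 * pi) * (ennreal (t ^ m * exp (- (real n * t))) * indicator {T..} t) \<partial>lborel)"
  proof (intro nn_integral_cong)
    fix t :: real
    have "pi * exp (- t) * (exp (- (real n * t)) * (2 * t ^ m * exp t)) = 2 * pi * (t ^ m * exp (- (real n * t)))"
      by (simp add: exp_minus field_simps)
    then show "ennreal (pi * exp (- t)) * (ennreal (exp (- (real n * t))) * (ennreal (2 * t ^ m * exp t) * indicator {T..} t))
      = ennreal (2 * pi) * (ennreal (t ^ m * exp (- (real n * t))) * indicator {T..} t)"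
      using T by (cases "T \<le> t") (simp_all flip: ennreal_mult ennreal_mult')
  qed
  also have "\<dots> = ennreal (2 * pi) * upper_gamma m T n"
    unfolding upper_gamma_def by (rule nn_integral_cmult) measurable
  finally show ?thesis .
qed

text \<open>Bessel's inequality on the unit circle is applied to \<open>f (z * u)\<close> as a
  function of \<open>u\<close>, multiplied by the weight and integrated over \<open>z\<close>.
  Fubini's theorem and the rotation invariance of the weight and of Lebesgue measure then recover
  the integral of \<open>f\<close> itself.\<close>

lemma weighted_bessel:
  assumes f: "f holomorphic_on ball 0 r" and \<rho>: "0 < \<rho>" "\<rho> < 1" "\<rho> < r"
  defines "T \<equiv> - ln (\<rho>\<^sup>2)"
  shows "(\<Sum>n\<le>M. ennreal ((cmod ((deriv ^^ n) f 0 / fact n))\<^sup>2) * (ennreal (2 * pi) * upper_gamma m T n))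
    \<le> (\<integral>\<^sup>+z. ennreal ((cmod (f z))\<^sup>2) * cusp_weight m T z \<partial>lborel)"
proof -
  define c where "c n = (deriv ^^ n) f 0 / fact n" for n
  \<comment> \<open>Nothing is known about \<open>f\<close> outside \<open>ball 0 r\<close>, not
    even measurability. The cutoff \<open>F\<close> is measurable and agrees with \<open>f\<close>
    wherever the weight is nonzero.\<close>
  define F where "F z = (if z \<in> cball 0 \<rho> then f z else 0)" for z
  define w where "w = cusp_weight m T"
  have [measurable]: "w \<in> borel_measurable borel" by (simp add: w_def)
  have T: "0 < T" using \<rho> by (simp add: T_def ln_realpow)
  have w_support: "w z = 0" if "cmod z > \<rho>" for z
  proof -
    have "ln (\<rho>\<^sup>2) < ln ((cmod z)\<^sup>2)"
      using that \<rho> by (intro ln_less_cancel_iff[THEN iffD2] power_strict_mono) auto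
    then show ?thesis by (simp add: w_def cusp_weight_def Let_def T_def)
  qed
  have w_rot: "w (u * z) = w z" if "cmod u = 1" for u z
    using that by (simp add: w_def cusp_weight_def norm_mult)
  have [measurable]: "F \<in> borel_measurable borel"
  proof -
    have "continuous_on (cball 0 \<rho>) f"
      using \<rho> by (intro holomorphic_on_imp_continuous_on holomorphic_on_subset[OF f]) auto
    then have "(\<lambda>z. indicator (cball 0 \<rho>) z *\<^sub>R f z) \<in> borel_measurable borel"
      by (intro borel_measurable_continuous_on_indicator) auto
    moreover have "F = (\<lambda>z. indicator (cball 0 \<rho>) z *\<^sub>R f z)"
      by (auto simp: F_def indicator_def)
    ultimately show ?thesis by simp
  qed
  have [measurable]: "cis \<in> borel_measurable borel"
    by (intro borel_measurable_continuous_onI continuous_intros)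
  have circle: "ennreal (\<Sum>n\<le>M. (cmod (c n))\<^sup>2 * (cmod z) ^ (2 * n)) * w z
      \<le> (\<integral>\<^sup>+t. indicator {0..1} t * ennreal ((cmod (F (cis (2 * pi * t) * z)))\<^sup>2) \<partial>lborel) * w z" for z
  proof (cases "cmod z \<le> \<rho>")
    case True
    then have zr: "cmod z < r" using \<rho> by simp
    have "(\<lambda>u. z * u) ` ball 0 (r / \<rho>) \<subseteq> ball 0 r"
    proof clarsimp
      fix u assume "cmod u < r / \<rho>"
      then have "\<rho> * cmod u < r"
        using \<rho> by (simp add: field_simps)
      moreover have "cmod z * cmod u \<le> \<rho> * cmod u"
        using True by (rule mult_right_mono) simp
      ultimately show "cmod (z * u) < r" by (simp add: norm_mult)
    qed
    then have "(\<lambda>u. f (z * u)) holomorphic_on ball 0 (r / \<rho>)"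
      by (intro holomorphic_on_compose_gen[OF _ f, unfolded o_def]) (auto intro!: holomorphic_intros)
    moreover have "1 < r / \<rho>" using \<rho> by simp
    ultimately have "ennreal (\<Sum>n\<le>M. (cmod ((deriv ^^ n) (\<lambda>u. f (z * u)) 0 / fact n))\<^sup>2)
      \<le> (\<integral>\<^sup>+t. indicator {0..1} t * ennreal ((cmod (f (z * cis (2 * pi * t))))\<^sup>2) \<partial>lborel)"
      by (rule bessel_unit_circle)
    moreover have "(cmod ((deriv ^^ n) (\<lambda>u. f (z * u)) 0 / fact n))\<^sup>2 = (cmod (c n))\<^sup>2 * (cmod z) ^ (2 * n)" for n
      unfolding higher_deriv_scale[OF f zr] c_def
      by (simp add: norm_divide norm_mult norm_power power_mult_distrib power_divide mult.commute flip: power_mult)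
    moreover have "f (z * cis (2 * pi * t)) = F (cis (2 * pi * t) * z)" for t
      using True by (simp add: F_def norm_mult mult.commute)
    ultimately show ?thesis by (intro mult_right_mono) simp_all
  qed (simp add: w_support)
  have "(\<Sum>n\<le>M. ennreal ((cmod (c n))\<^sup>2) * (ennreal (2 * pi) * upper_gamma m T n))
      = (\<Sum>n\<le>M. ennreal ((cmod (c n))\<^sup>2) * (\<integral>\<^sup>+z. ennreal ((cmod z) ^ (2 * n)) * w z \<partial>lborel))"
    by (simp add: nn_integral_power_cusp_weight[OF T] w_def)
  also have "\<dots> = (\<integral>\<^sup>+z. (\<Sum>n\<le>M. ennreal ((cmod (c n))\<^sup>2) * (ennreal ((cmod z) ^ (2 * n)) * w z)) \<partial>lborel)"
    by (subst nn_integral_sum) (simp_all add: nn_integral_cmult)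
  also have "\<dots> = (\<integral>\<^sup>+z. ennreal (\<Sum>n\<le>M. (cmod (c n))\<^sup>2 * (cmod z) ^ (2 * n)) * w z \<partial>lborel)"
    by (simp add: sum_distrib_right ennreal_mult mult.assoc flip: sum_ennreal)
  also have "\<dots> \<le> (\<integral>\<^sup>+z. (\<integral>\<^sup>+t. indicator {0..1} t * ennreal ((cmod (F (cis (2 * pi * t) * z)))\<^sup>2) \<partial>lborel) * w z \<partial>lborel)"
    by (intro nn_integral_mono circle)
  also have "\<dots> = (\<integral>\<^sup>+z. (\<integral>\<^sup>+t. indicator {0..1} t * ennreal ((cmod (F (cis (2 * pi * t) * z)))\<^sup>2) * w z \<partial>lborel) \<partial>lborel)"
    by (intro nn_integral_cong nn_integral_multc[symmetric]) measurable
  also have "\<dots> = (\<integral>\<^sup>+t. (\<integral>\<^sup>+z. indicator {0..1} t * ennreal ((cmod (F (cis (2 * pi * t) * z)))\<^sup>2) * w z \<partial>lborel) \<partial>lborel)"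
    by (rule lborel_pair.Fubini'[symmetric]) measurable
  \<comment> \<open>For each \<open>t\<close> the rotation by \<open>cis (2 * pi * t)\<close> leaves
    the inner integral unchanged, so averaging over \<open>t\<close> has no effect.\<close>
  also have "\<dots> = (\<integral>\<^sup>+t. indicator {0..1::real} t * (\<integral>\<^sup>+z. ennreal ((cmod (F z))\<^sup>2) * w z \<partial>lborel) \<partial>lborel)"
  proof (rule nn_integral_cong)
    fix t :: real
    have "(\<integral>\<^sup>+z. indicator {0..1} t * ennreal ((cmod (F (cis (2 * pi * t) * z)))\<^sup>2) * w z \<partial>lborel)
        = (\<integral>\<^sup>+z. indicator {0..1} t * (ennreal ((cmod (F (cis (2 * pi * t) * z)))\<^sup>2) * w (cis (2 * pi * t) * z)) \<partial>lborel)"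
      by (simp add: w_rot mult.assoc)
    also have "\<dots> = indicator {0..1} t * (\<integral>\<^sup>+z. ennreal ((cmod (F (cis (2 * pi * t) * z)))\<^sup>2) * w (cis (2 * pi * t) * z) \<partial>lborel)"
      by (rule nn_integral_cmult) measurable
    also have "(\<integral>\<^sup>+z. ennreal ((cmod (F (cis (2 * pi * t) * z)))\<^sup>2) * w (cis (2 * pi * t) * z) \<partial>lborel)
        = (\<integral>\<^sup>+z. ennreal ((cmod (F z))\<^sup>2) * w z \<partial>lborel)"
      by (rule nn_integral_lborel_complex_rotate) simp_all
    finally show "(\<integral>\<^sup>+z. indicator {0..1} t * ennreal ((cmod (F (cis (2 * pi * t) * z)))\<^sup>2) * w z \<partial>lborel)
        = indicator {0..1} t * (\<integral>\<^sup>+z. ennreal ((cmod (F z))\<^sup>2) * w z \<partial>lborel)" .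
  qed
  also have "\<dots> = (\<integral>\<^sup>+z. ennreal ((cmod (F z))\<^sup>2) * w z \<partial>lborel)"
    by (subst nn_integral_multc) (simp_all add: nn_integral_indicator)
  also have "\<dots> = (\<integral>\<^sup>+z. ennreal ((cmod (f z))\<^sup>2) * w z \<partial>lborel)"
    by (intro nn_integral_cong) (auto simp: F_def w_support)
  finally show ?thesis by (simp add: c_def w_def)
qed

section \<open>Incomplete gamma integrals\<close>

text \<open>Normalization of the Erlang density of shape \<open>m + 1\<close> and rate
  \<open>l\<close>.\<close>

lemma nn_integral_power_exp:
  assumes l: "0 < l"
  shows "(\<integral>\<^sup>+t. ennreal (t ^ m * exp (- (l * t))) * indicator {0..} t \<partial>lborel) = ennreal (fact m / l ^ Suc m)"
proof -
  have "(\<integral>\<^sup>+t. ennreal (erlang_density m l t) \<partial>lborel) = 1"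
    using prob_space.emeasure_space_1[OF prob_space_erlang_density[OF l, of m]] by (simp add: emeasure_density)
  moreover have "ennreal (t ^ m * exp (- (l * t))) * indicator {0..} t
      = ennreal (fact m / l ^ Suc m) * ennreal (erlang_density m l t)" for t
    using l by (cases "0 \<le> t") (simp_all add: erlang_density_def field_simps flip: ennreal_mult)
  ultimately show ?thesis
    using l by (simp add: nn_integral_cmult)
qed

text \<open>The mass below \<open>T\<close> is a fraction of the total mass by Markov's inequality for \<open>1 / t\<close>.\<close>

lemma lower_gamma_le:
  assumes l: "0 < l" and T: "0 < T" and m: "0 < m"
  shows "(\<integral>\<^sup>+t. ennreal (t ^ m * exp (- (l * t))) * indicator {0..<T} t \<partial>lborel)
    \<le> ennreal (l * T / m * (fact m / l ^ Suc m))"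
proof -
  obtain j where j: "m = Suc j" using m by (cases m) auto
  have "(\<integral>\<^sup>+t. ennreal (t ^ m * exp (- (l * t))) * indicator {0..<T} t \<partial>lborel)
      \<le> (\<integral>\<^sup>+t. ennreal T * (ennreal (t ^ j * exp (- (l * t))) * indicator {0..} t) \<partial>lborel)"
  proof (intro nn_integral_mono)
    fix t
    show "ennreal (t ^ m * exp (- (l * t))) * indicator {0..<T} t
      \<le> ennreal T * (ennreal (t ^ j * exp (- (l * t))) * indicator {0..} t)"
    proof (cases "0 \<le> t \<and> t < T")
      case True
      then have "t * (t ^ j * exp (- (l * t))) \<le> T * (t ^ j * exp (- (l * t)))"
        by (intro mult_right_mono) auto
      then show ?thesis
        using True T by (simp add: j mult.assoc ennreal_leI flip: ennreal_mult)
    qed auto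
  qed
  also have "\<dots> = ennreal T * ennreal (fact j / l ^ Suc j)"
    by (simp add: nn_integral_cmult nn_integral_power_exp[OF l])
  also have "\<dots> = ennreal (l * T / m * (fact m / l ^ Suc m))"
  proof -
    have "l * T / m * (fact m / l ^ Suc m) = T * (fact j / l ^ Suc j)"
      using l by (simp add: j divide_simps)
    then show ?thesis using l T by (simp only:) (simp flip: ennreal_mult)
  qed
  finally show ?thesis .
qed

text \<open>Markov's inequality for \<open>t\<close>: on the region of integration
  \<open>1 \<le> t / C\<close>, and the extra factor \<open>t\<close> multiplies the full gamma
  integral by \<open>(m + 1) / l\<close>.\<close>

lemma far_gamma_le:
  assumes l: "0 < l" and C: "0 < C"
  shows "(\<integral>\<^sup>+t. ennreal (t ^ m * exp (- (l * t))) * indicator {C<..} t \<partial>lborel)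
    \<le> ennreal ((real m + 1) / (l * C) * (fact m / l ^ Suc m))"
proof -
  have "(\<integral>\<^sup>+t. ennreal (t ^ m * exp (- (l * t))) * indicator {C<..} t \<partial>lborel)
      \<le> (\<integral>\<^sup>+t. ennreal (1 / C) * (ennreal (t ^ Suc m * exp (- (l * t))) * indicator {0..} t) \<partial>lborel)"
  proof (intro nn_integral_mono)
    fix t
    show "ennreal (t ^ m * exp (- (l * t))) * indicator {C<..} t
      \<le> ennreal (1 / C) * (ennreal (t ^ Suc m * exp (- (l * t))) * indicator {0..} t)"
    proof (cases "C < t")
      case True
      then have "1 * (t ^ m * exp (- (l * t))) \<le> (t / C) * (t ^ m * exp (- (l * t)))"
        using C by (intro mult_right_mono) auto
      then show ?thesis
        using True C by (simp add: ennreal_leI mult_ac flip: ennreal_mult)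
    qed auto
  qed
  also have "\<dots> = ennreal (1 / C) * ennreal (fact (Suc m) / l ^ Suc (Suc m))"
    unfolding nn_integral_power_exp[OF l, symmetric] by (rule nn_integral_cmult) measurable
  also have "\<dots> = ennreal ((real m + 1) / (l * C) * (fact m / l ^ Suc m))"
  proof -
    have "(real m + 1) / (l * C) * (fact m / l ^ Suc m) = (1 / C) * (fact (Suc m) / l ^ Suc (Suc m))"
      using l C by (simp add: field_simps)
    then show ?thesis using l C by (simp only:) (simp flip: ennreal_mult)
  qed
  finally show ?thesis .
qed

text \<open>Serves to bound one piece of a split integral from below without subtracting in
  \<open>ennreal\<close>.\<close>

lemma ennreal_le_if_le_add:
  assumes "ennreal a \<le> x + ennreal b" "0 \<le> b" "c \<le> a - b"
  shows "ennreal c \<le> x"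
proof (cases x)
  case (real y)
  then have "a \<le> y + b" using assms by (simp flip: ennreal_plus)
  then show ?thesis using real assms by (simp add: ennreal_leI)
qed simp

text \<open>By \<open>lower_gamma_le\<close> the mass below \<open>T\<close> is at most the fraction
  \<open>n * T / m \<le> 1 / 2\<close> of the total.\<close>

lemma upper_gamma_ge_half:
  assumes n: "0 < n" and T: "0 < T" and m: "0 < m" and nT: "n * T \<le> m / 2"
  shows "ennreal (fact m / real n ^ Suc m / 2) \<le> upper_gamma m T n"
proof -
  define A where "A = fact m / real n ^ Suc m"
  define p where "p t = ennreal (t ^ m * exp (- (real n * t)))" for t
  have [measurable]: "p \<in> borel_measurable borel" unfolding p_def by measurable
  have A: "0 \<le> A" by (simp add: A_def)
  have "ennreal A = (\<integral>\<^sup>+t. p t * indicator {0..} t \<partial>lborel)"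
    using n by (simp add: nn_integral_power_exp A_def p_def del: power_Suc)
  also have "\<dots> = (\<integral>\<^sup>+t. p t * indicator {T..} t + p t * indicator {0..<T} t \<partial>lborel)"
    using T by (intro nn_integral_cong) (auto simp: indicator_def)
  also have "\<dots> = upper_gamma m T n + (\<integral>\<^sup>+t. p t * indicator {0..<T} t \<partial>lborel)"
    unfolding upper_gamma_def p_def[symmetric] by (rule nn_integral_add) measurable
  also have "\<dots> \<le> upper_gamma m T n + ennreal (n * T / m * A)"
    unfolding p_def A_def using n T m by (intro add_left_mono lower_gamma_le) auto
  finally show ?thesis
    unfolding A_def[symmetric]
  proof (rule ennreal_le_if_le_add)
    have "n * T / m \<le> 1 / 2" using nT m by (simp add: field_simps)
    then have "n * T / m * A \<le> 1 / 2 * A" using A by (rule mult_right_mono)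
    then show "A / 2 \<le> A - n * T / m * A" by simp
  qed (use A T in auto)
qed

text \<open>A quarter of the mass of the density for \<open>N\<close> lies in \<open>[T, C]\<close>, where passing from \<open>N\<close>
  to \<open>n\<close> costs at most the factor \<open>exp ((n - N) C)\<close>.\<close>

lemma upper_gamma_ge_tail:
  assumes N: "0 < N" and T: "0 < T" and m: "0 < m" and NT: "N * T \<le> m / 2"
    and C: "C = 4 * (real m + 1) / N" and n: "N \<le> n"
  shows "ennreal (exp (- (real (n - N) * C)) * (fact m / real N ^ Suc m / 4)) \<le> upper_gamma m T n"
proof -
  define A where "A = fact m / real N ^ Suc m"
  define p where "p t = ennreal (t ^ m * exp (- (real N * t)))" for t
  have [measurable]: "p \<in> borel_measurable borel" unfolding p_def by measurable
  have A: "0 \<le> A" by (simp add: A_def)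
  have C0: "0 < C" using N by (simp add: C)
  have "ennreal A = (\<integral>\<^sup>+t. p t * indicator {0..} t \<partial>lborel)"
    using N by (simp add: nn_integral_power_exp A_def p_def del: power_Suc)
  \<comment> \<open>An inequality holds whatever the order of \<open>T\<close> and \<open>C\<close>;
    the last two intervals would overlap if \<open>C < T\<close>.\<close>
  also have "\<dots> \<le> (\<integral>\<^sup>+t. p t * indicator {T..C} t + (p t * indicator {0..<T} t + p t * indicator {C<..} t) \<partial>lborel)"
    by (intro nn_integral_mono) (auto simp: indicator_def)
  also have "\<dots> = (\<integral>\<^sup>+t. p t * indicator {T..C} t \<partial>lborel)
      + ((\<integral>\<^sup>+t. p t * indicator {0..<T} t \<partial>lborel) + (\<integral>\<^sup>+t. p t * indicator {C<..} t \<partial>lborel))"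
    by (simp add: nn_integral_add)
  also have "\<dots> \<le> (\<integral>\<^sup>+t. p t * indicator {T..C} t \<partial>lborel)
      + (ennreal (N * T / m * A) + ennreal ((real m + 1) / (N * C) * A))"
    unfolding p_def A_def using N T m C0 far_gamma_le[of N C m]
    by (intro add_left_mono add_mono lower_gamma_le) simp_all
  also have "\<dots> = (\<integral>\<^sup>+t. p t * indicator {T..C} t \<partial>lborel) + ennreal (N * T / m * A + (real m + 1) / (N * C) * A)"
    using T A C0 by (subst ennreal_plus) auto
  finally have quarter: "ennreal (A / 4) \<le> (\<integral>\<^sup>+t. p t * indicator {T..C} t \<partial>lborel)"
  proof (rule ennreal_le_if_le_add)
    have half_quarter: "A / 4 \<le> A - (x + y)" if "x \<le> 1 / 2 * A" "y = A / 4" for x y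
      using that by linarith
    have "N * T / m \<le> 1 / 2" using NT m by (simp add: field_simps)
    then have "N * T / m * A \<le> 1 / 2 * A" using A by (rule mult_right_mono)
    \<comment> \<open>This is the reason for the 4 in \<open>C\<close>: at most a quarter of the
      mass lies above \<open>C\<close> and at most half below \<open>T\<close>.\<close>
    moreover have "N * C = 4 * (real m + 1)"
      using N by (simp add: C)
    then have "(real m + 1) / (N * C) * A = A / 4"
      by (simp add: field_simps)
    ultimately show "A / 4 \<le> A - (N * T / m * A + (real m + 1) / (N * C) * A)"
      using half_quarter by blast
  qed (use A T C0 in auto)
  have "ennreal (exp (- (real (n - N) * C)) * (A / 4)) \<le> ennreal (exp (- (real (n - N) * C))) * (\<integral>\<^sup>+t. p t * indicator {T..C} t \<partial>lborel)"
    using quarter A by (subst ennreal_mult) (auto intro!: mult_left_mono)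
  also have "\<dots> = (\<integral>\<^sup>+t. ennreal (exp (- (real (n - N) * C))) * (p t * indicator {T..C} t) \<partial>lborel)"
    by (rule nn_integral_cmult[symmetric]) measurable
  also have "\<dots> \<le> upper_gamma m T n"
    unfolding upper_gamma_def
  proof (intro nn_integral_mono)
    fix t
    show "ennreal (exp (- (real (n - N) * C))) * (p t * indicator {T..C} t)
      \<le> ennreal (t ^ m * exp (- (real n * t))) * indicator {T..} t"
    proof (cases "T \<le> t \<and> t \<le> C")
      case True
      have "exp (- (real (n - N) * C)) \<le> exp (- (real (n - N) * t))"
        using True by (simp add: mult_left_mono)
      then have "exp (- (real (n - N) * C)) * (t ^ m * exp (- (real N * t)))
          \<le> exp (- (real (n - N) * t)) * (t ^ m * exp (- (real N * t)))"
        using True T by (intro mult_right_mono) auto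
      also have "\<dots> = t ^ m * (exp (- (real (n - N) * t)) * exp (- (real N * t)))"
        by simp
      also have "exp (- (real (n - N) * t)) * exp (- (real N * t)) = exp (- (real n * t))"
        unfolding mult_exp_exp using n by (simp add: of_nat_diff algebra_simps)
      finally show ?thesis
        using True T by (simp add: p_def ennreal_leI flip: ennreal_mult)
    qed auto
  qed
  finally show ?thesis by (simp add: A_def)
qed

text \<open>Forces the constant coefficient of a function of finite norm to vanish. The integrand is
  at least \<open>T ^ m\<close> on a half-line of infinite length.\<close>

lemma upper_gamma_0:
  assumes T: "0 < T"
  shows "upper_gamma m T 0 = \<infinity>"
proof -
  have "(SUP n::nat. of_nat n) \<le> emeasure lborel {T..}"
  proof (rule SUP_least)
    fix n :: nat
    have "emeasure lborel {T..T + n} \<le> emeasure lborel {T..}"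
      by (rule emeasure_mono) auto
    then show "of_nat n \<le> emeasure lborel {T..}" by (simp add: ennreal_of_nat_eq_real_of_nat)
  qed
  then have "\<infinity> = ennreal (T ^ m) * emeasure lborel {T..}"
    using T by (simp add: ennreal_SUP_of_nat_eq_top ennreal_mult_top top_unique)
  also have "\<dots> = (\<integral>\<^sup>+t. ennreal (T ^ m) * indicator {T..} t \<partial>lborel)"
    by (simp add: nn_integral_cmult_indicator)
  also have "\<dots> \<le> upper_gamma m T 0"
    unfolding upper_gamma_def
    using T by (intro nn_integral_mono) (auto simp: indicator_def intro!: ennreal_leI power_mono)
  finally show ?thesis by (simp add: top_unique)
qed

section \<open>The pointwise bound on the punctured disc\<close>

text \<open>Induction on \<open>p\<close> by termwise differentiation: \<open>diffs\<close> turns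
  the coefficients \<open>real n ^ p\<close> into \<open>real (Suc n) ^ Suc p\<close>, whence the
  shifted index in the induction.\<close>

lemma summable_power_times_geometric:
  fixes q :: real
  assumes q: "\<bar>q\<bar> < 1"
  shows "summable (\<lambda>n. real n ^ p * q ^ n)"
proof -
  have "\<forall>x. \<bar>x\<bar> < 1 \<longrightarrow> summable (\<lambda>n. real (Suc n) ^ p * x ^ n)" for p
  proof (induction p)
    case 0
    show ?case by (simp add: summable_geometric)
  next
    case (Suc p)
    show ?case
    proof (intro allI impI)
      fix x :: real assume x: "\<bar>x\<bar> < 1"
      have "summable (\<lambda>n. real n ^ p * y ^ n)" if "\<bar>y\<bar> < 1" for y
      proof (subst summable_Suc_iff[symmetric])
        show "summable (\<lambda>n. real (Suc n) ^ p * y ^ Suc n)"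
          using summable_mult[of "\<lambda>n. real (Suc n) ^ p * y ^ n" y] Suc.IH that by (simp add: mult_ac)
      qed
      then have "summable (\<lambda>n. diffs (\<lambda>n. real n ^ p) n * x ^ n)"
        using x by (intro termdiff_converges[of x 1]) auto
      then show "summable (\<lambda>n. real (Suc n) ^ Suc p * x ^ n)"
        by (simp add: diffs_def)
    qed
  qed
  then have "summable (\<lambda>n. q * (real (Suc n) ^ p * q ^ n))"
    using q by (intro summable_mult) auto
  then show ?thesis
    by (subst summable_Suc_iff[symmetric]) (simp add: mult_ac)
qed

lemma sum_geometric_third_above_le:
  "(\<Sum>n=1..M. if n \<le> N then 0 else (1 / 3 :: real) ^ (n - N)) \<le> 1 / 2"
proof -
  \<comment> \<open>The subtracted remainder makes the induction work. For \<open>M \<le> N\<close>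
    truncated subtraction gives \<open>M - N = 0\<close>, and the bound is 0.\<close>
  have "(\<Sum>n=1..M. if n \<le> N then 0 else (1 / 3 :: real) ^ (n - N)) \<le> 1 / 2 - (1 / 3) ^ (M - N) / 2"
  proof (induction M)
    case (Suc M)
    show ?case
    proof (cases "Suc M \<le> N")
      case False
      then have "(1 / 3 :: real) ^ (M - N) = 3 * (1 / 3) ^ (Suc M - N)"
        by (simp add: Suc_diff_le)
      then show ?thesis using Suc False by simp
    qed (use Suc in simp)
  qed simp
  then show ?thesis
    by (rule order_trans) simp
qed

text \<open>The lower bounds for \<open>upper_gamma m T n\<close> in \<open>upper_gamma_ge_half\<close> and
  \<open>upper_gamma_ge_tail\<close>, used below and above the cutoff \<open>N\<close>.\<close>

definition gamma_weight :: "nat \<Rightarrow> nat \<Rightarrow> real \<Rightarrow> nat \<Rightarrow> real" where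
  "gamma_weight m N C n =
     (if n \<le> N then fact m / real n ^ Suc m / 2
      else exp (- (real (n - N) * C)) * (fact m / real N ^ Suc m / 4))"

text \<open>Source of the constant 4: the terms up to \<open>N\<close> contribute at most
  \<open>2 * S\<close>. Those above \<open>N\<close> are at most
  \<open>4 * s N / 3 ^ (n - N)\<close>, which add up to at most
  \<open>2 * s N \<le> 2 * S\<close>.\<close>

lemma sum_divide_gamma_weight_le:
  assumes N: "0 < N" and q: "0 \<le> q" and qC: "q * exp C \<le> 1 / 3" and C: "0 \<le> C"
  shows "(\<Sum>n=1..M. q ^ n / gamma_weight m N C n)
    \<le> 4 * (\<Sum>a. real (Suc a) ^ Suc m * q ^ Suc a) / fact m"
proof -
  define s where "s n = real n ^ Suc m * q ^ n / fact m" for n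
  define S where "S = (\<Sum>a. s (Suc a))"
  have s_nonneg: "0 \<le> s n" for n using q by (simp add: s_def)
  have "q \<le> 1 / 3"
    using order_trans[OF mult_left_mono[of 1 "exp C" q] qC] C q by simp
  then have "summable (\<lambda>n. real n ^ Suc m * q ^ n)"
    using q by (intro summable_power_times_geometric) auto
  then have summable_raw: "summable (\<lambda>a. real (Suc a) ^ Suc m * q ^ Suc a)"
    by (subst (asm) summable_Suc_iff[symmetric])
  then have summable_s: "summable (\<lambda>a. s (Suc a))"
    unfolding s_def by (rule summable_divide)
  have S_eq: "S = (\<Sum>a. real (Suc a) ^ Suc m * q ^ Suc a) / fact m"
    unfolding S_def s_def by (rule suminf_divide[OF summable_raw])
  have "(\<Sum>n=1..M. s n) = (\<Sum>a<M. s (Suc a))"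
    by (simp add: sum.atLeast1_atMost_eq)
  also have "\<dots> \<le> S"
    unfolding S_def by (rule sum_le_suminf[OF summable_s]) (simp_all add: s_nonneg)
  finally have partial: "(\<Sum>n=1..M. s n) \<le> S" .
  have sN: "s N \<le> S"
    using sum_le_suminf[OF summable_s, of "{N - 1}"] N s_nonneg by (simp add: S_def)
  have "(\<Sum>n=1..M. q ^ n / gamma_weight m N C n)
      \<le> (\<Sum>n=1..M. 2 * s n + 4 * s N * (if n \<le> N then 0 else (1 / 3) ^ (n - N)))"
  proof (rule sum_mono)
    fix n
    show "q ^ n / gamma_weight m N C n \<le> 2 * s n + 4 * s N * (if n \<le> N then 0 else (1 / 3) ^ (n - N))"
    proof (cases "n \<le> N")
      case True
      then show ?thesis by (simp add: gamma_weight_def s_def mult_ac)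
    next
      case False
      then have "q ^ n = q ^ N * q ^ (n - N)" by (simp flip: power_add)
      moreover have "gamma_weight m N C n = fact m / real N ^ Suc m / 4 / exp C ^ (n - N)"
        using False unfolding gamma_weight_def exp_minus exp_of_nat_mult by (simp add: field_simps)
      ultimately have "q ^ n / gamma_weight m N C n = 4 * s N * (q * exp C) ^ (n - N)"
        by (simp add: s_def power_mult_distrib mult_ac)
      also have "\<dots> \<le> 4 * s N * (1 / 3) ^ (n - N)"
        using q qC s_nonneg by (intro mult_left_mono power_mono) auto
      finally show ?thesis using False s_nonneg[of n] by simp
    qed
  qed
  also have "\<dots> = 2 * (\<Sum>n=1..M. s n) + 4 * s N * (\<Sum>n=1..M. if n \<le> N then 0 else (1 / 3) ^ (n - N))"
    by (simp only: sum.distrib sum_distrib_left)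
  also have "\<dots> \<le> 2 * S + 4 * s N * (1 / 2)"
    using s_nonneg partial by (intro add_mono mult_left_mono sum_geometric_third_above_le) auto
  also have "\<dots> \<le> 4 * S" using sN by simp
  finally show ?thesis by (simp add: S_eq)
qed

text \<open>The integer part of \<open>2 * w ^ 6\<close> is the largest \<open>N\<close> for which
  \<open>T \<le> w\<^sup>2 / 4\<close> alone guarantees \<open>N * T \<le> m / 2\<close>. The 2 in
  the bound on \<open>C\<close> is spent later on \<open>exp (- 2) \<le> 1 / 3\<close>.\<close>

lemma cutoff_exists:
  fixes w T :: real
  assumes w: "3 \<le> w" and m: "real m = w ^ 8" and T: "0 < T" "T \<le> w\<^sup>2 / 4"
  obtains N :: nat and C :: real
  where "0 < N" "real N * T \<le> real m / 2" "C = 4 * (real m + 1) / N" "C \<le> w ^ 3 - 2"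
proof -
  define N where "N = nat \<lfloor>2 * w ^ 6\<rfloor>"
  define C where "C = 4 * (real m + 1) / N"
  have w6: "3 ^ 6 \<le> w ^ 6" and w8: "3 ^ 8 \<le> w ^ 8" and w2: "3 ^ 2 \<le> w ^ 2"
    using w by (intro power_mono; simp)+
  have "real N \<le> 2 * w ^ 6" unfolding N_def using w6 by (simp add: of_nat_nat)
  then have "real N * T \<le> (2 * w ^ 6) * (w\<^sup>2 / 4)"
    using T by (intro mult_mono) auto
  also have "\<dots> = real m / 2" by (simp add: m flip: power_add)
  finally have NT: "real N * T \<le> real m / 2" .
  have "2 * w ^ 6 - 1 \<le> real N" unfolding N_def using w6 by linarith
  \<comment> \<open>Since \<open>w ^ 6 \<ge> 729\<close>, rounding down costs less than
    \<open>w ^ 6 / 10\<close>.\<close>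
  then have N_ge: "19 / 10 * w ^ 6 \<le> real N" using w6 by simp
  then have N0: "0 < real N" using w6 by simp
  have "4 * (real m + 1) \<le> 22 / 10 * w\<^sup>2 * (19 / 10 * w ^ 6)"
    using w8 by (simp add: m flip: power_add)
  also have "\<dots> \<le> 22 / 10 * w\<^sup>2 * real N"
    using N_ge by (intro mult_left_mono) auto
  finally have "C \<le> 22 / 10 * w\<^sup>2"
    using N0 by (simp add: C_def field_simps)
  moreover have "9 * (8 / 10) \<le> w\<^sup>2 * (w - 22 / 10)"
    using w w2 by (intro mult_mono) auto
  then have "9 * (8 / 10) \<le> w ^ 3 - 22 / 10 * w\<^sup>2"
    by (simp add: power3_eq_cube power2_eq_square algebra_simps)
  ultimately have "C \<le> w ^ 3 - 2" by simp
  then show ?thesis using that[of N C] N0 NT C_def by simp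
qed

text \<open>Places the region of the estimate inside the disc of integration, hence inside the disc
  of convergence; the reason is \<open>w\<^sup>2 / 4 < w ^ 3\<close>.\<close>

lemma cusp_region_subset:
  fixes w \<rho> x :: real
  assumes w: "3 \<le> w" and \<rho>: "0 < \<rho>" and T: "- ln (\<rho>\<^sup>2) \<le> w\<^sup>2 / 4" and x: "x\<^sup>2 \<le> exp (- (w ^ 3))"
  shows "x < \<rho>"
proof -
  have "w\<^sup>2 / 4 < 3 * w\<^sup>2" using w by simp
  also have "\<dots> \<le> w * w\<^sup>2" using w by (intro mult_right_mono) auto
  also have "\<dots> = w ^ 3" by (simp add: power3_eq_cube power2_eq_square)
  finally have "exp (- (w ^ 3)) < exp (ln (\<rho>\<^sup>2))" using T by simp
  also have "\<dots> = \<rho>\<^sup>2" using \<rho> by simp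
  finally show ?thesis using x \<rho> by (intro power2_less_imp_less[of x \<rho>]) auto
qed

text \<open>The estimate in the coordinate \<open>z\<close>, freed from the geometry. For
  \<open>k = m + 2\<close> the last factor is \<open>4 * rho0 k z\<close> without the power of the
  logarithm, which the norm on the left also contains and which is restored at the end.\<close>

theorem punctured_disc_pointwise_bound:
  fixes f :: "complex \<Rightarrow> complex" and w :: real
  assumes f: "f holomorphic_on ball 0 r" and \<rho>: "0 < \<rho>" "\<rho> < 1" "\<rho> < r"
    and w: "3 \<le> w" and m: "real m = w ^ 8" and T: "- ln (\<rho>\<^sup>2) \<le> w\<^sup>2 / 4"
    and z: "z \<noteq> 0" "(cmod z)\<^sup>2 \<le> exp (- (w ^ 3))"
  defines "I \<equiv> (\<integral>\<^sup>+z. ennreal ((cmod (f z))\<^sup>2) * cusp_weight m (- ln (\<rho>\<^sup>2)) z \<partial>lborel)"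
  shows "ennreal ((cmod (f z))\<^sup>2)
    \<le> I * ennreal (4 * (\<Sum>a. real (Suc a) ^ Suc m * cmod z ^ (2 * Suc a)) / (2 * pi * fact m))"
proof -
  define T where "T = - ln (\<rho>\<^sup>2)"
  define q where "q = (cmod z)\<^sup>2"
  define c where "c n = (deriv ^^ n) f 0 / fact n" for n
  define B where "B = 4 * (\<Sum>a. real (Suc a) ^ Suc m * q ^ Suc a) / fact m"
  have T0: "0 < T" using \<rho> by (simp add: T_def ln_realpow)
  have m0: "0 < m" using m w by (metis gr0I of_nat_0 power_eq_0_iff zero_neq_numeral not_numeral_le_zero)
  obtain N C where N: "0 < N" "real N * T \<le> real m / 2" and C: "C = 4 * (real m + 1) / N" "C \<le> w ^ 3 - 2"
    using cutoff_exists[OF w m T0] T unfolding T_def by blast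
  have C0: "0 < C" using N C by simp
  have q0: "0 < q" using z by (simp add: q_def)
  have "q * exp C \<le> exp (- (w ^ 3)) * exp C"
    using z by (intro mult_right_mono) (auto simp: q_def)
  also have "\<dots> \<le> exp (- 2)" using C by (simp add: mult_exp_exp)
  also have "\<dots> \<le> 1 / 3"
    using exp_ge_add_one_self[of "2::real"] by (simp add: exp_minus field_simps)
  finally have qC: "q * exp C \<le> 1 / 3" .
  define j where "j = gamma_weight m N C"
  have j_pos: "0 < j n" if "0 < n" for n
    using that N by (simp add: j_def gamma_weight_def)
  have j_le: "ennreal (j n) \<le> upper_gamma m T n" if "0 < n" for n
  proof (cases "n \<le> N")
    case True
    then have "real n * T \<le> real N * T" using T0 by (intro mult_right_mono) auto
    then show ?thesis
      using upper_gamma_ge_half[OF that T0 m0] N True by (simp add: j_def gamma_weight_def)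
  next
    case False
    then show ?thesis
      using upper_gamma_ge_tail[OF N(1) T0 m0 N(2) C(1), of n] by (simp add: j_def gamma_weight_def)
  qed
  have B: "(\<Sum>n=1..M. q ^ n / j n) \<le> B" for M
    unfolding B_def j_def using q0 C0 by (intro sum_divide_gamma_weight_le N qC) auto
  have bessel: "(\<Sum>n\<le>M. ennreal ((cmod (c n))\<^sup>2) * (ennreal (2 * pi) * upper_gamma m T n)) \<le> I" for M
    unfolding c_def T_def I_def by (rule weighted_bessel[OF f \<rho>])
  \<comment> \<open>Needed when \<open>I\<close> is infinite, since infinity times 0 is 0 in
    \<open>ennreal\<close>.\<close>
  have B_pos: "0 < B"
  proof (rule less_le_trans)
    show "0 < q / j 1" using q0 j_pos[of 1] by simp
    show "q / j 1 \<le> B" using B[of 1] by simp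
  qed
  have main: "ennreal ((cmod (f z))\<^sup>2) \<le> I * ennreal (B / (2 * pi))"
  proof (cases I)
    case (real i)
    have c0: "c 0 = 0"
    proof (rule ccontr)
      assume "c 0 \<noteq> 0"
      then have "I = \<infinity>"
        using bessel[of 0] by (simp add: upper_gamma_0[OF T0] ennreal_mult_top top_unique)
      then show False using real by simp
    qed
    have weighted: "(\<Sum>n=1..M. (cmod (c n))\<^sup>2 * j n) \<le> i / (2 * pi)" for M
    proof -
      have "ennreal (\<Sum>n=1..M. (cmod (c n))\<^sup>2 * (2 * pi * j n))
          = (\<Sum>n=1..M. ennreal ((cmod (c n))\<^sup>2 * (2 * pi * j n)))"
        using j_pos by (intro sum_ennreal[symmetric]) (simp add: less_imp_le)
      also have "\<dots> = (\<Sum>n=1..M. ennreal ((cmod (c n))\<^sup>2) * (ennreal (2 * pi) * ennreal (j n)))"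
        using j_pos by (intro sum.cong refl) (simp add: ennreal_mult less_imp_le)
      also have "\<dots> \<le> (\<Sum>n=1..M. ennreal ((cmod (c n))\<^sup>2) * (ennreal (2 * pi) * upper_gamma m T n))"
        by (intro sum_mono mult_left_mono j_le) simp_all
      also have "\<dots> \<le> (\<Sum>n\<le>M. ennreal ((cmod (c n))\<^sup>2) * (ennreal (2 * pi) * upper_gamma m T n))"
        by (rule sum_mono2) simp_all
      also have "\<dots> \<le> ennreal i" using bessel real by simp
      finally have "(\<Sum>n=1..M. (cmod (c n))\<^sup>2 * (2 * pi * j n)) \<le> i"
        using real by simp
      then have "2 * pi * (\<Sum>n=1..M. (cmod (c n))\<^sup>2 * j n) \<le> i"
        by (simp add: sum_distrib_left mult_ac)
      then show ?thesis by (simp add: field_simps)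
    qed
    have partial: "(cmod (\<Sum>n<Suc M. c n * z ^ n))\<^sup>2 \<le> i / (2 * pi) * B" for M
    proof -
      have "(\<Sum>n<Suc M. c n * z ^ n) = (\<Sum>n=1..M. c n * z ^ n)"
        by (subst sum.lessThan_Suc_shift) (simp add: c0 sum.atLeast1_atMost_eq)
      then have "cmod (\<Sum>n<Suc M. c n * z ^ n) \<le> (\<Sum>n=1..M. cmod (c n) * cmod z ^ n)"
        using norm_sum[of "\<lambda>n. c n * z ^ n" "{1..M}"] by (simp add: norm_mult norm_power)
      then have "(cmod (\<Sum>n<Suc M. c n * z ^ n))\<^sup>2 \<le> (\<Sum>n=1..M. cmod (c n) * cmod z ^ n)\<^sup>2"
        by (rule power_mono) simp
      \<comment> \<open>The factors \<open>sqrt (j n)\<close> let Cauchy-Schwarz separate the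
        coefficients, controlled by Bessel's inequality, from the sum bounded by
        \<open>B\<close>.\<close>
      also have "(\<Sum>n=1..M. cmod (c n) * cmod z ^ n)
          = (\<Sum>n=1..M. (cmod (c n) * sqrt (j n)) * (cmod z ^ n / sqrt (j n)))"
        using j_pos[THEN less_imp_neq] by (intro sum.cong) auto
      also have "\<dots>\<^sup>2 \<le> (\<Sum>n=1..M. (cmod (c n) * sqrt (j n))\<^sup>2) * (\<Sum>n=1..M. (cmod z ^ n / sqrt (j n))\<^sup>2)"
        by (rule Cauchy_Schwarz_ineq_sum)
      also have "(\<Sum>n=1..M. (cmod (c n) * sqrt (j n))\<^sup>2) = (\<Sum>n=1..M. (cmod (c n))\<^sup>2 * j n)"
        using j_pos by (intro sum.cong) (auto simp: power_mult_distrib less_imp_le)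
      also have "(\<Sum>n=1..M. (cmod z ^ n / sqrt (j n))\<^sup>2) = (\<Sum>n=1..M. q ^ n / j n)"
        using j_pos by (intro sum.cong) (auto simp: power_divide less_imp_le q_def mult.commute simp flip: power_mult)
      also have "(\<Sum>n=1..M. (cmod (c n))\<^sup>2 * j n) * (\<Sum>n=1..M. q ^ n / j n) \<le> i / (2 * pi) * B"
        using real q0 j_pos by (intro mult_mono weighted B sum_nonneg) (auto simp: less_imp_le)
      finally show ?thesis .
    qed
    have "cmod z < \<rho>"
      using w \<rho>(1) T z(2) by (rule cusp_region_subset)
    then have "(\<lambda>n. c n * (z - 0) ^ n) sums f z"
      unfolding c_def using \<rho> by (intro holomorphic_power_series[OF f]) auto
    then have "(\<lambda>M. \<Sum>n<M. c n * z ^ n) \<longlonglongrightarrow> f z"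
      by (simp add: sums_def)
    then have "(\<lambda>M. (cmod (\<Sum>n<Suc M. c n * z ^ n))\<^sup>2) \<longlonglongrightarrow> (cmod (f z))\<^sup>2"
      by (intro tendsto_intros LIMSEQ_Suc)
    then have "(cmod (f z))\<^sup>2 \<le> i / (2 * pi) * B"
      by (rule LIMSEQ_le_const2) (use partial in auto)
    then show ?thesis
      using real B_pos by (simp add: ennreal_leI flip: ennreal_mult)
  next
    case top
    then show ?thesis using B_pos by (simp add: ennreal_top_mult)
  qed
  have "B / (2 * pi) = 4 * (\<Sum>a. real (Suc a) ^ Suc m * cmod z ^ (2 * Suc a)) / (2 * pi * fact m)"
    unfolding B_def q_def power_mult by simp
  with main show ?thesis by simp
qed

section \<open>Sections of powers of the line bundle\<close>

lemma frame_in_fibre: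
  assumes "is_triv X L t" "p \<in> fst t"
  shows "frame L t p \<in> fibre L p" "snd t (frame L t p) = 1"
proof -
  have bij: "bij_betw (snd t) (fibre L p) UNIV"
    using assms by (simp add: is_triv_def)
  then have "1 \<in> snd t ` fibre L p" by (simp add: bij_betw_def)
  then show "frame L t p \<in> fibre L p" "snd t (frame L t p) = 1"
    unfolding frame_def by (rule inv_into_into, rule f_inv_into_f)
qed

text \<open>\<open>power_metric\<close> evaluates an arbitrarily chosen representative
  \<open>(c, u)\<close>. Every choice satisfies \<open>c * snd t u ^ k = \<alpha> p\<close>, and
  \<open>h\<close> scales by the squared modulus of the fibre coordinate, so the choice is
  immaterial.\<close>

lemma power_metric_power_section:
  assumes L: "holomorphic_line_bundle X L" and h: "singular_hermitian_metric X L h"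
    and t: "t \<in> local_trivs X L" and p: "p \<in> fst t"
  shows "power_metric k h (power_section L k t \<alpha> p) = ennreal ((cmod (\<alpha> p))\<^sup>2) * h (frame L t p) ^ k"
proof -
  define v where "v = frame L t p"
  have triv: "is_triv X L t" using t by (simp add: local_trivs_def)
  then have v: "v \<in> fibre L p" "snd t v = 1"
    using p unfolding v_def by (rule frame_in_fibre)+
  then have proj: "bundle_proj L v = p" and total: "v \<in> total_space L"
    by (auto simp: fibre_def)
  \<comment> \<open>Tensors are compared in the members of \<open>triv_atlas\<close>, to which
    \<open>t\<close> need not belong. Over \<open>p\<close> the coordinates differ by a nonzero
    factor, whose \<open>k\<close>-th power cancels.\<close>
  have transition: "\<exists>g. g \<noteq> 0 \<and> (\<forall>u\<in>fibre L p. snd t' u = g * snd t u)"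
    if "t' \<in> triv_atlas L" "p \<in> fst t'" for t'
  proof -
    have "trivs_compatible X L t t'" using t that by (simp add: local_trivs_def)
    then obtain g where "\<forall>p\<in>fst t \<inter> fst t'. g p \<noteq> 0 \<and> (\<forall>u\<in>fibre L p. snd t' u = g p * snd t u)"
      unfolding trivs_compatible_def by blast
    then show ?thesis using p that by blast
  qed
  have "nonzero_vec L v"
    unfolding nonzero_vec_def proj using total v transition by fastforce
  then have "(\<alpha> p, v) \<in> power_section L k t \<alpha> p"
    using v by (simp add: power_section_def tensor_elem_def proj v_def[symmetric])
  then have some_mem: "(SOME x. x \<in> power_section L k t \<alpha> p) \<in> power_section L k t \<alpha> p"
    by (rule someI)
  obtain c u where cu: "(SOME x. x \<in> power_section L k t \<alpha> p) = (c, u)" by fastforce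
  have u: "u \<in> fibre L p"
    and cu_eq: "\<And>t'. t' \<in> triv_atlas L \<Longrightarrow> p \<in> fst t' \<Longrightarrow> c * snd t' u ^ k = \<alpha> p * snd t' v ^ k"
    using some_mem unfolding cu by (auto simp: power_section_def tensor_elem_def proj v_def[symmetric])
  have "p \<in> points X"
    using triv p openin_subset unfolding is_triv_def by blast
  then obtain t' where t': "t' \<in> triv_atlas L" "p \<in> fst t'"
    using L unfolding holomorphic_line_bundle_def by blast
  obtain g where "g \<noteq> 0" and g: "\<forall>u\<in>fibre L p. snd t' u = g * snd t u"
    using transition[OF t'] by blast
  then have coord: "c * snd t u ^ k = \<alpha> p"
    using cu_eq[OF t'] u v by (simp add: power_mult_distrib)
  have "h u = ennreal ((cmod (snd t u))\<^sup>2) * h v"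
    using h t p u unfolding singular_hermitian_metric_def v_def by blast
  then have "power_metric k h (power_section L k t \<alpha> p)
      = ennreal ((cmod c)\<^sup>2) * (ennreal ((cmod (snd t u))\<^sup>2) * h v) ^ k"
    by (simp add: power_metric_def cu)
  also have "\<dots> = ennreal ((cmod c)\<^sup>2) * ennreal (((cmod (snd t u))\<^sup>2) ^ k) * h v ^ k"
    by (simp add: power_mult_distrib ennreal_power mult.assoc)
  also have "ennreal ((cmod c)\<^sup>2) * ennreal (((cmod (snd t u))\<^sup>2) ^ k) = ennreal ((cmod (c * snd t u ^ k))\<^sup>2)"
    by (simp add: norm_mult norm_power power_mult_distrib mult.commute flip: ennreal_mult power_mult)
  finally show ?thesis by (simp add: coord v_def)
qed

lemma chart_inv_inverse:
  assumes c: "is_chart T c"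
  shows "p \<in> fst c \<Longrightarrow> chart_inv c (snd c p) = p"
    and "z \<in> snd c ` fst c \<Longrightarrow> chart_inv c z \<in> fst c \<and> snd c (chart_inv c z) = z"
proof -
  have "topspace (subtopology T (fst c)) = fst c"
    using c openin_subset unfolding is_chart_def by fastforce
  then have inj: "inj_on (snd c) (fst c)"
    using c homeomorphic_imp_injective_map unfolding is_chart_def by metis
  then show "p \<in> fst c \<Longrightarrow> chart_inv c (snd c p) = p"
    by (simp add: chart_inv_def)
  show "z \<in> snd c ` fst c \<Longrightarrow> chart_inv c z \<in> fst c \<and> snd c (chart_inv c z) = z"
    unfolding chart_inv_def by (simp add: inv_into_into f_inv_into_f)
qed

text \<open>With \<open>l = - ln ((cmod z)\<^sup>2)\<close>, two of the \<open>k\<close> logarithms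
  cancel against those of the form, and \<open>1 / (cmod z)\<^sup>2\<close> is \<open>exp l\<close>.
  This is why \<open>m = k - 2\<close>.\<close>

lemma cusp_density_eq_cusp_weight:
  assumes z: "z \<noteq> 0" "cmod z < 1" and k: "2 \<le> k"
  shows "\<bar>ln ((cmod z)\<^sup>2)\<bar> ^ k * (2 * (1 / ((cmod z)\<^sup>2 * (ln ((cmod z)\<^sup>2))\<^sup>2)))
    = 2 * (- ln ((cmod z)\<^sup>2)) ^ (k - 2) * exp (- ln ((cmod z)\<^sup>2))"
proof -
  define l where "l = - ln ((cmod z)\<^sup>2)"
  have "0 < l" using z by (simp add: l_def ln_realpow)
  moreover have "l ^ k = l ^ (k - 2) * l\<^sup>2" using k by (metis le_add_diff_inverse2 power_add)
  moreover have "exp l = 1 / (cmod z)\<^sup>2" using z by (simp add: l_def exp_minus field_simps)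
  moreover have "ln ((cmod z)\<^sup>2) = - l" by (simp add: l_def)
  ultimately show ?thesis by simp
qed

theorem lemma3p5:
  fixes X :: "'a surface"
    and D :: "'a set"
    and \<omega> :: "'a form11"
    and L :: "('a, 'e) line_bundle"
    and h :: "'e \<Rightarrow> ennreal"
    and d :: int
    and V :: "'a \<Rightarrow> 'a set"
    and \<zeta> :: "'a \<Rightarrow> 'a \<Rightarrow> complex"
    and \<tau> :: "'a \<Rightarrow> 'e \<Rightarrow> complex"
    and R :: "'a \<Rightarrow> real"
    and \<epsilon> lambda \<nu> :: real
    and k :: nat
    and a :: 'a
    and \<alpha> :: "'a \<Rightarrow> complex"
  assumes X: "compact_riemann_surface X"
    and D: "finite D" "D \<subseteq> points X"
    and \<omega>: "hermitian_form_on X (points X - D) \<omega>"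
    and L: "holomorphic_line_bundle X L" "has_degree X L d" "d > 0"
    and h: "singular_hermitian_metric X L h"
    and h_smooth: "metric_smooth_on X L h (points X - D)"
    and V: "\<And>b. b \<in> D \<Longrightarrow> V b \<inter> D = {b}"
    and coord: "\<And>b. b \<in> D \<Longrightarrow> (V b, \<zeta> b) \<in> holo_charts X"
    and centered: "\<And>b. b \<in> D \<Longrightarrow> \<zeta> b b = 0"
    and triv: "\<And>b. b \<in> D \<Longrightarrow> (V b, \<tau> b) \<in> local_trivs X L"
    and h_cusp: "\<And>b p. b \<in> D \<Longrightarrow> p \<in> V b - {b} \<Longrightarrow>
           h (frame L (V b, \<tau> b) p) = ennreal \<bar>ln ((cmod (\<zeta> b p))\<^sup>2)\<bar>"
    and \<epsilon>: "\<epsilon> > 0"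
    and curv_ge: "form_ge_on X (points X - D) (i_curvature X L h) (form_scale \<epsilon> \<omega>)"
    and curv_cusp: "\<And>b. b \<in> D \<Longrightarrow> form_eq_on X (V b - {b}) (i_curvature X L h) \<omega>"
    and \<omega>_cusp: "\<And>b p. b \<in> D \<Longrightarrow> p \<in> V b - {b} \<Longrightarrow>
           \<omega> (V b, \<zeta> b) p = 1 / ((cmod (\<zeta> b p))\<^sup>2 * (ln ((cmod (\<zeta> b p))\<^sup>2))\<^sup>2)"
    and R: "\<And>b. b \<in> D \<Longrightarrow> 0 < R b \<and> R b \<le> 1 / 2 \<and> cball 0 (R b) \<subseteq> \<zeta> b ` V b"
    and ricci: "form_ge_on X (points X - D) (ricci_form \<omega>) (form_scale lambda \<omega>)"
    and a: "a \<in> D"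
    and k_pos: "k > 0" and k_ricci: "\<epsilon> + lambda / real k > 0"
    and k1: "ln (real k) + ln (- ln (R a)) - ln (\<epsilon> + lambda / real k) > 0"
    and k2: "real k \<ge> (- 9 * ln (R a / 2)) ^ 4"
    and k3: "k \<ge> 23190"
    and \<alpha>: "holo_fun_on X \<alpha> (V a)"
    and norm_le: "form_integral (V a, \<zeta> a) {p \<in> V a - {a}. cmod (\<zeta> a p) \<le> R a / 2}
           (\<lambda>p. power_metric k h (power_section L k (V a, \<tau> a) \<alpha> p)) \<omega> \<le> ennreal \<nu>"
  shows "\<forall>z. z \<noteq> 0 \<and> (cmod z)\<^sup>2 \<le> exp (- ((real k - 2) powr (3 / 8))) \<longrightarrow>
           (\<exists>p\<in>V a. \<zeta> a p = z \<and>
              power_metric k h (power_section L k (V a, \<tau> a) \<alpha> p) \<le> ennreal (4 * \<nu> * rho0 k z))"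
proof (intro allI impI)
  define m where "m = k - 2"
  define w where "w = real m powr (1 / 8)"
  define c where "c = (V a, \<zeta> a)"
  define g where "g = chart_inv c"
  define f where "f z = \<alpha> (g z)" for z
  define \<rho> where "\<rho> = R a / 2"
  define I where "I = (\<integral>\<^sup>+z. ennreal ((cmod (f z))\<^sup>2) * cusp_weight m (- ln (\<rho>\<^sup>2)) z \<partial>lborel)"
  have Ra: "0 < R a" "R a \<le> 1 / 2" "cball 0 (R a) \<subseteq> \<zeta> a ` V a"
    using R[OF a] by auto
  have \<rho>: "0 < \<rho>" "\<rho> < 1" "\<rho> < R a" using Ra by (auto simp: \<rho>_def)
  have km: "k = m + 2" using k3 by (simp add: m_def)
  have w8: "real m = w ^ 8"
    using k3 by (simp add: w_def m_def powr_power)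
  have w0: "0 \<le> w" by (simp add: w_def)
  \<comment> \<open>Otherwise \<open>m \<le> 3 ^ 8 = 6561\<close>, contrary to
    \<open>k3\<close>.\<close>
  have w: "3 \<le> w"
  proof (rule ccontr)
    assume "\<not> 3 \<le> w"
    then have "w ^ 8 \<le> 3 ^ 8" using w0 by (intro power_mono) auto
    then show False using w8 k3 km by simp
  qed
  have w3: "(real k - 2) powr (3 / 8) = w ^ 3"
    using k3 by (simp add: w_def km powr_power)
  \<comment> \<open>If this failed, \<open>k2\<close> would give
    \<open>(9 / 8) ^ 4 * m < k = m + 2\<close>, impossible for \<open>m\<close> this large.\<close>
  have T: "- ln (\<rho>\<^sup>2) \<le> w\<^sup>2 / 4"
  proof (rule ccontr)
    assume "\<not> ?thesis"
    then have "9 / 8 * w\<^sup>2 < - 9 * ln \<rho>"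
      using \<rho> by (simp add: ln_realpow)
    then have "(9 / 8 * w\<^sup>2) ^ 4 < (- 9 * ln \<rho>) ^ 4"
      by (intro power_strict_mono) auto
    also have "\<dots> \<le> real k" using k2 by (simp add: \<rho>_def)
    also have "(9 / 8 * w\<^sup>2) ^ 4 = (9 / 8) ^ 4 * real m"
      unfolding power_mult_distrib w8 by (simp flip: power_mult)
    finally have "(9 / 8) ^ 4 * real m < real k" .
    then show False using k3 km by (simp add: power4_eq_xxxx)
  qed
  have chart: "is_chart (space_top X) c"
    using coord[OF a] by (simp add: c_def holo_charts_def)
  have inv: "g z \<in> V a" "\<zeta> a (g z) = z" if "z \<in> \<zeta> a ` V a" for z
    using chart_inv_inverse(2)[OF chart, of z] that by (simp_all add: c_def g_def)
  have inv': "g (\<zeta> a p) = p" if "p \<in> V a" for p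
    using chart_inv_inverse(1)[OF chart, of p] that by (simp add: c_def g_def)
  have inv_ne: "g z \<in> V a - {a}" if "z \<in> \<zeta> a ` V a" "z \<noteq> 0" for z
    using inv[OF that(1)] that centered[OF a] by auto
  have "(\<alpha> \<circ> g) holomorphic_on \<zeta> a ` V a"
    using \<alpha> coord[OF a] unfolding holo_fun_on_def g_def c_def by force
  then have f: "f holomorphic_on ball 0 (R a)"
    unfolding f_def o_def using Ra ball_subset_cball by (blast intro: holomorphic_on_subset)
  have power_norm: "power_metric k h (power_section L k (V a, \<tau> a) \<alpha> (g z))
      = ennreal ((cmod (f z))\<^sup>2) * ennreal (\<bar>ln ((cmod z)\<^sup>2)\<bar> ^ k)" if "z \<in> \<zeta> a ` V a" "z \<noteq> 0" for z
    using power_metric_power_section[OF L(1) h triv[OF a], of "g z" k \<alpha>]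
      inv[OF that(1)] h_cusp[OF a inv_ne[OF that]]
    by (simp add: f_def ennreal_power)
  define B where "B = {p \<in> V a - {a}. cmod (\<zeta> a p) \<le> R a / 2}"
  \<comment> \<open>The image is the whole punctured disc: on \<open>V a\<close> the injective
    coordinate vanishes only at \<open>a\<close>, which \<open>B\<close> omits.\<close>
  have B_iff: "z \<in> \<zeta> a ` B \<longleftrightarrow> z \<noteq> 0 \<and> cmod z \<le> \<rho>" for z
  proof
    assume "z \<in> \<zeta> a ` B"
    then obtain p where p: "p \<in> V a" "p \<noteq> a" "z = \<zeta> a p" "cmod z \<le> \<rho>" by (auto simp: B_def \<rho>_def)
    moreover have "a \<in> V a" using V[OF a] by blast
    ultimately have "\<zeta> a p \<noteq> \<zeta> a a" using inv' by metis
    then show "z \<noteq> 0 \<and> cmod z \<le> \<rho>" using p centered[OF a] by simp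
  next
    assume z: "z \<noteq> 0 \<and> cmod z \<le> \<rho>"
    then have "z \<in> \<zeta> a ` V a" using Ra \<rho> by force
    then have "g z \<in> B" "\<zeta> a (g z) = z"
      using inv inv_ne z by (auto simp: B_def \<rho>_def)
    then show "z \<in> \<zeta> a ` B" by force
  qed
  have "form_integral c B (\<lambda>p. power_metric k h (power_section L k (V a, \<tau> a) \<alpha> p)) \<omega> = I"
    unfolding form_integral_def I_def
  proof (rule nn_integral_cong)
    fix z :: complex
    show "power_metric k h (power_section L k (V a, \<tau> a) \<alpha> (chart_inv c z))
          * ennreal (2 * \<omega> c (chart_inv c z)) * indicator (snd c ` B) z
        = ennreal ((cmod (f z))\<^sup>2) * cusp_weight m (- ln (\<rho>\<^sup>2)) z"
    proof (cases "z \<noteq> 0 \<and> cmod z \<le> \<rho>")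
      case True
      then have zV: "z \<in> \<zeta> a ` V a" using Ra \<rho> by force
      have z: "z \<noteq> 0" "cmod z < 1" using True \<rho> by auto
      have "\<omega> c (g z) = 1 / ((cmod z)\<^sup>2 * (ln ((cmod z)\<^sup>2))\<^sup>2)"
        using \<omega>_cusp[OF a inv_ne[OF zV z(1)]] inv[OF zV] by (simp add: c_def)
      moreover have "ln ((cmod z)\<^sup>2) \<le> ln (\<rho>\<^sup>2)"
        using True by (intro ln_mono power_mono) auto
      then have "cusp_weight m (- ln (\<rho>\<^sup>2)) z = ennreal (2 * (- ln ((cmod z)\<^sup>2)) ^ m * exp (- ln ((cmod z)\<^sup>2)))"
        by (simp add: cusp_weight_def Let_def)
      then have "cusp_weight m (- ln (\<rho>\<^sup>2)) z
          = ennreal (\<bar>ln ((cmod z)\<^sup>2)\<bar> ^ k) * ennreal (2 * (1 / ((cmod z)\<^sup>2 * (ln ((cmod z)\<^sup>2))\<^sup>2)))"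
        using cusp_density_eq_cusp_weight[OF z, of k] km by (simp flip: ennreal_mult)
      moreover have "z \<in> snd c ` B" using B_iff[of z] True by (simp add: c_def)
      ultimately show ?thesis
        using power_norm[OF zV z(1)] by (simp add: mult.assoc flip: g_def)
    next
      case False
      then have "z \<notin> snd c ` B" using B_iff[of z] by (auto simp: c_def)
      moreover have "cusp_weight m (- ln (\<rho>\<^sup>2)) z = 0"
      proof -
        \<comment> \<open>This includes \<open>z = 0\<close>, because \<open>ln 0 = 0\<close> and
          \<open>\<rho> < 1\<close>.\<close>
        have "ln (\<rho>\<^sup>2) < ln ((cmod z)\<^sup>2)"
        proof (cases "z = 0")
          case True
          then show ?thesis using \<rho> by (simp add: ln_realpow)
        next
          case nonzero: False
          then have "\<rho>\<^sup>2 < (cmod z)\<^sup>2" using False \<rho> by (intro power_strict_mono) auto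
          then show ?thesis using \<rho> nonzero by simp
        qed
        then show ?thesis by (simp add: cusp_weight_def Let_def)
      qed
      ultimately show ?thesis by simp
    qed
  qed
  then have I: "I \<le> ennreal \<nu>" using norm_le by (simp add: c_def B_def)
  fix z :: complex
  assume "z \<noteq> 0 \<and> (cmod z)\<^sup>2 \<le> exp (- ((real k - 2) powr (3 / 8)))"
  then have z: "z \<noteq> 0" "(cmod z)\<^sup>2 \<le> exp (- (w ^ 3))" by (simp_all add: w3)
  define S where "S = (\<Sum>n. real (Suc n) ^ Suc m * cmod z ^ (2 * Suc n))"
  have bound: "ennreal ((cmod (f z))\<^sup>2) \<le> I * ennreal (4 * S / (2 * pi * fact m))"
    unfolding I_def S_def by (rule punctured_disc_pointwise_bound[OF f \<rho> w w8 T z])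
  have "cmod z < \<rho>"
    using w \<rho>(1) T z(2) by (rule cusp_region_subset)
  then have zV: "z \<in> \<zeta> a ` V a" and z1: "cmod z < 1" using Ra \<rho> by force+
  have l: "\<bar>ln ((cmod z)\<^sup>2)\<bar> = ln (1 / (cmod z)\<^sup>2)"
    using z(1) z1 by (simp add: ln_div ln_realpow)
  have rho: "4 * rho0 k z = 4 * S / (2 * pi * fact m) * ln (1 / (cmod z)\<^sup>2) ^ k"
    by (simp add: rho0_def S_def km)
  have "summable (\<lambda>n. real n ^ Suc m * (cmod z)\<^sup>2 ^ n)"
    using z1 by (intro summable_power_times_geometric) (simp add: abs_square_less_1)
  then have "summable (\<lambda>n. real (Suc n) ^ Suc m * cmod z ^ (2 * Suc n))"
    unfolding power_mult by (subst (asm) summable_Suc_iff[symmetric])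
  then have "0 \<le> S"
    unfolding S_def by (rule suminf_nonneg) simp
  then have S_nonneg: "0 \<le> 4 * S / (2 * pi * fact m)" by simp
  have l_nonneg: "0 \<le> ln (1 / (cmod z)\<^sup>2) ^ k" by (simp flip: l)
  have rho_nonneg: "0 \<le> 4 * rho0 k z"
    unfolding rho using S_nonneg l_nonneg by (rule mult_nonneg_nonneg)
  have "power_metric k h (power_section L k (V a, \<tau> a) \<alpha> (g z))
      \<le> I * ennreal (4 * S / (2 * pi * fact m)) * ennreal (ln (1 / (cmod z)\<^sup>2) ^ k)"
    unfolding power_norm[OF zV z(1)] l using bound by (rule mult_right_mono) simp
  also have "\<dots> = I * ennreal (4 * rho0 k z)"
    unfolding rho ennreal_mult[OF S_nonneg l_nonneg] by (simp only: mult.assoc)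
  also have "\<dots> \<le> ennreal \<nu> * ennreal (4 * rho0 k z)"
    using I by (rule mult_right_mono) simp
  \<comment> \<open>The sign of \<open>rho0 k z\<close> is enough here: for negative
    \<open>\<nu>\<close> both sides are 0.\<close>
  also have "\<dots> = ennreal (4 * \<nu> * rho0 k z)"
    using rho_nonneg by (subst ennreal_mult''[symmetric]) (simp_all add: mult_ac)
  finally show "\<exists>p\<in>V a. \<zeta> a p = z \<and>
      power_metric k h (power_section L k (V a, \<tau> a) \<alpha> p) \<le> ennreal (4 * \<nu> * rho0 k z)"
    using inv[OF zV] by blast
qed

end
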